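(* Let $k$ be a field. A (nondegenerate) finite Gorenstein scheme in $\mathbf{P}^2_k$ is self-associated if and only if it is a complete intersection of a conic and a cubic.
   Context: A finite $k$-scheme is Gorenstein if its local rings are. For a nondegenerate (contained in no hyperplane) finite Gorenstein scheme $\Gamma\subset\mathbf{P}^r=\mathbf{P}(V)$ ($V$ the space of linear forms) with dualizing line bundle $K_\Gamma$, Serre duality gives a trace map $\mathrm{H}^0(K_\Gamma)\to k$ and, via multiplication, a perfect pairing $\mathrm{H}^0(\mathcal{O}_\Gamma(1))\otimes\mathrm{H}^0(K_\Gamma(-1))\to k$; $V^\perp$ is the annihilator of $V\subset\mathrm{H}^0(\mathcal{O}_\Gamma(1))$. $\Gamma$ is self-associated if there is an isomorphism of $\mathcal{O}_\Gamma$-modules $\mathcal{O}_\Gamma(1)\to K_\Gamma(-1)$ carrying $V$ onto $V^\perp$ (in particular $\deg\Gamma=2r+2$). *)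

theory Defs
  imports Complex_Main "HOL-Library.Poly_Mapping" "HOL-Library.Numeral_Type" "HOL-Algebra.Ring"
begin

text \<open>
  The polynomial ring $k[x_i : i \in n]$ is the type \<open>('n \<Rightarrow>\<^sub>0 nat) \<Rightarrow>\<^sub>0 'k\<close> of finitely supported
  functions on exponent vectors; its ideals are the submodules for the action \<open>(*)\<close>, so the
  ideal generated by a set \<open>X\<close> is \<open>module.span (*) X\<close>.
\<close>

type_synonym ('n, 'k) mpoly = "('n \<Rightarrow>\<^sub>0 nat) \<Rightarrow>\<^sub>0 'k"

definition form :: "nat \<Rightarrow> ('n::finite, 'k::zero) mpoly \<Rightarrow> bool"
  where "form d F \<longleftrightarrow> (\<forall>m \<in> Poly_Mapping.keys F. (\<Sum>i\<in>UNIV. Poly_Mapping.lookup m i) = d)"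

definition poly_value ::
    "('k::field \<Rightarrow> 'a::comm_ring_1) \<Rightarrow> ('n::finite, 'k) mpoly \<Rightarrow> ('n \<Rightarrow> 'a) \<Rightarrow> 'a"
  where "poly_value \<iota> F x = (\<Sum>m \<in> Poly_Mapping.keys F.
           \<iota> (Poly_Mapping.lookup F m) * (\<Prod>i\<in>UNIV. x i ^ Poly_Mapping.lookup m i))"


section \<open>Local rings and the Gorenstein property\<close>

definition prime_ideal :: "'a::comm_ring_1 set \<Rightarrow> bool"
  where "prime_ideal P \<longleftrightarrow> module.subspace (*) P \<and> 1 \<notin> P \<and> (\<forall>a b. a * b \<in> P \<longrightarrow> a \<in> P \<or> b \<in> P)"

text \<open>The localization $A_P$, whose elements are the classes of fractions $a/s$ with $s \notin P$.\<close>

definition frac_rel :: "'a::comm_ring_1 set \<Rightarrow> (('a \<times> 'a) \<times> ('a \<times> 'a)) set"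
  where "frac_rel P = {((a, s), (b, t)). s \<notin> P \<and> t \<notin> P \<and> (\<exists>u. u \<notin> P \<and> u * (a * t - b * s) = 0)}"

definition frac :: "'a::comm_ring_1 set \<Rightarrow> 'a \<Rightarrow> 'a \<Rightarrow> ('a \<times> 'a) set"
  where "frac P a s = frac_rel P `` {(a, s)}"

definition local_ring_at :: "'a::comm_ring_1 set \<Rightarrow> ('a \<times> 'a) set ring"
  where "local_ring_at P =
    \<lparr> carrier = (UNIV \<times> (- P)) // frac_rel P,
      mult = (\<lambda>X Y. \<Union>(a, s)\<in>X. \<Union>(b, t)\<in>Y. frac P (a * b) (s * t)),
      one = frac P 1 1,
      zero = frac P 0 1,
      add = (\<lambda>X Y. \<Union>(a, s)\<in>X. \<Union>(b, t)\<in>Y. frac P (a * t + b * s) (s * t)) \<rparr>"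

text \<open>
  Let $R$ be a local ring that is a finite-dimensional algebra over $k$ via \<open>j\<close>. Its dualizing
  module is $\omega_R = \mathrm{Hom}_k(R, k)$ with $(x \varphi)(z) = \varphi(x z)$, and the
  zero-dimensional local ring $R$ is Gorenstein when $R \cong \omega_R$ as $R$-modules (Eisenbud,
  Commutative Algebra, Section 21.2).
\<close>

definition local_dual :: "('r, 'm) ring_scheme \<Rightarrow> ('k::field \<Rightarrow> 'r) \<Rightarrow> ('r \<Rightarrow> 'k) set"
  where "local_dual R j = {\<phi> \<in> extensional (carrier R).
    (\<forall>x \<in> carrier R. \<forall>y \<in> carrier R. \<phi> (x \<oplus>\<^bsub>R\<^esub> y) = \<phi> x + \<phi> y) \<and>
    (\<forall>c. \<forall>x \<in> carrier R. \<phi> (j c \<otimes>\<^bsub>R\<^esub> x) = c * \<phi> x)}"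

definition gorenstein_local_ring :: "('r, 'm) ring_scheme \<Rightarrow> ('k::field \<Rightarrow> 'r) \<Rightarrow> bool"
  where "gorenstein_local_ring R j \<longleftrightarrow> (\<exists>\<Theta>. bij_betw \<Theta> (carrier R) (local_dual R j) \<and>
    (\<forall>x \<in> carrier R. \<forall>y \<in> carrier R.
       \<Theta> (x \<oplus>\<^bsub>R\<^esub> y) = (\<lambda>z \<in> carrier R. \<Theta> x z + \<Theta> y z) \<and>
       \<Theta> (x \<otimes>\<^bsub>R\<^esub> y) = (\<lambda>z \<in> carrier R. \<Theta> y (x \<otimes>\<^bsub>R\<^esub> z))))"


section \<open>Finite subschemes of projective space\<close>

text \<open>Locally free of rank one: on each member \<open>D(f)\<close> of some cover of $\mathrm{Spec}\,A$ by
  principal open sets there is \<open>e\<close> such that $A_f \to L_f$, $a \mapsto a e$, is bijective. The two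
  inner conditions are surjectivity and injectivity of this map with denominators cleared.\<close>

definition line_bundle :: "('a::comm_ring_1 \<Rightarrow> 'l::ab_group_add \<Rightarrow> 'l) \<Rightarrow> bool"
  where "line_bundle scale \<longleftrightarrow> module scale \<and>
    (\<exists>C. module.span (*) C = (UNIV :: 'a set) \<and>
      (\<forall>f \<in> C. \<exists>e.
        (\<forall>l. \<exists>n a. scale (f ^ n) l = scale a e) \<and>
        (\<forall>a. scale a e = 0 \<longrightarrow> (\<exists>n. f ^ n * a = 0))))"

text \<open>
  A finite $k$-scheme is $\Gamma = \mathrm{Spec}\,A$ for a finite-dimensional $k$-algebra
  \<open>\<iota> : k \<rightarrow> A\<close>; coherent sheaves on $\Gamma$ and their homomorphisms are identified with
  finitely generated $A$-modules and $A$-linear maps, via global sections. (That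
  \<open>'a\<close> is in class \<open>comm_ring_1\<close> excludes only the empty scheme, which lies in every hyperplane.)
  A morphism $\Gamma \to \mathbf{P}^r$ is a line bundle \<open>L = \<O>(1)\<close> (the type \<open>'l\<close> with
  action \<open>scale\<close>) together with $r + 1$ sections \<open>s i\<close>, the restrictions of the coordinates \<open>x\<^sub>i\<close>,
  that generate it. Here \<open>CARD('n) = r + 1\<close>.

  Equality in $L^{\otimes d}$ of two sections of degree $d$ in elements of $L$ is tested by
  applying every \<open>\<xi> \<in> Hom\<^sub>A(L, A)\<close>, that is, the map
  $\xi^{\otimes d} : L^{\otimes d} \to A$. This is enough: for a trivialization
  $L_f \cong A_f$, some power of $f$ times it comes from a global \<open>\<xi>\<close>.

  The morphism is a closed immersion iff, for each $i$, the ring map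
  $k[x_j/x_i : j] \to \mathcal{O}(\Gamma_{s_i})$, $x_j/x_i \mapsto s_j/s_i$, is surjective, where
  $\Gamma_{s_i}$ is the (affine) open set where $s_i$ generates $L$. As the
  algebra $\mathcal{O}(\Gamma_{s_i})$ is generated by the $l/s_i$ with $l \in L$, this means that
  for each $l$ there is a form $F$ of some degree $d + 1$ with $F(s) = s_i^d\, l$ in
  $L^{\otimes (d+1)}$.
\<close>

locale finite_projective_scheme =
  fixes \<iota> :: "'k::field \<Rightarrow> 'a::comm_ring_1"
    and scale :: "'a \<Rightarrow> 'l::ab_group_add \<Rightarrow> 'l"
    and s :: "'n::finite \<Rightarrow> 'l"
  assumes \<iota>_one: "\<iota> 1 = 1"
    and \<iota>_add: "\<iota> (c + d) = \<iota> c + \<iota> d"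
    and \<iota>_mult: "\<iota> (c * d) = \<iota> c * \<iota> d"
    and finite_dim: "\<exists>B. finite B \<and> module.span (\<lambda>c a. \<iota> c * a) B = UNIV"
    and line_bundle: "line_bundle scale"
    and generated: "module.span scale (range s) = UNIV"
    and closed_immersion:
      "\<exists>d F. form (Suc d) F \<and>
         (\<forall>\<xi>. module_hom scale (*) \<xi> \<longrightarrow> poly_value \<iota> F (\<xi> \<circ> s) = \<xi> (s i) ^ d * \<xi> l)"
begin

definition gorenstein :: bool
  where "gorenstein \<longleftrightarrow>
    (\<forall>P. prime_ideal P \<longrightarrow> gorenstein_local_ring (local_ring_at P) (\<lambda>c. frac P (\<iota> c) 1))"

definition nondegenerate :: bool
  where "nondegenerate \<longleftrightarrow> (\<forall>c. (\<Sum>i\<in>UNIV. scale (\<iota> (c i)) (s i)) = 0 \<longrightarrow> (\<forall>i. c i = 0))"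

text \<open>\<open>V\<close> is the image in $\mathrm{H}^0(\mathcal{O}_\Gamma(1))$ of the space of linear forms.\<close>

definition V :: "'l set"
  where "V = module.span (\<lambda>c. scale (\<iota> c)) (range s)"

text \<open>\<open>K\<close> is $K_\Gamma = \mathrm{Hom}_k(A, k)$, with $A$-action \<open>K_scale\<close>.\<close>

definition K :: "('a \<Rightarrow> 'k) set"
  where "K = {\<phi>. Vector_Spaces.linear (\<lambda>c a. \<iota> c * a) (*) \<phi>}"

definition K_scale :: "'a \<Rightarrow> ('a \<Rightarrow> 'k) \<Rightarrow> 'a \<Rightarrow> 'k"
  where "K_scale a \<phi> = (\<lambda>b. \<phi> (a * b))"

definition trace :: "('a \<Rightarrow> 'k) \<Rightarrow> 'k"
  where "trace \<phi> = \<phi> 1"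

text \<open>\<open>K_minus_one\<close> is $K_\Gamma(-1) = \mathrm{Hom}_A(L, K_\Gamma)$; the multiplication
  $L \otimes K_\Gamma(-1) \to K_\Gamma$ is evaluation \<open>(l, \<psi>) \<mapsto> \<psi> l\<close>.\<close>

definition K_minus_one :: "('l \<Rightarrow> 'a \<Rightarrow> 'k) set"
  where "K_minus_one = {\<psi>. range \<psi> \<subseteq> K \<and>
    (\<forall>l m. \<psi> (l + m) = (\<lambda>b. \<psi> l b + \<psi> m b)) \<and>
    (\<forall>a l. \<psi> (scale a l) = K_scale a (\<psi> l))}"

definition V_perp :: "('l \<Rightarrow> 'a \<Rightarrow> 'k) set"
  where "V_perp = {\<psi> \<in> K_minus_one. \<forall>v \<in> V. trace (\<psi> v) = 0}"

definition self_associated :: bool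
  where "self_associated \<longleftrightarrow> (\<exists>\<Phi>. bij_betw \<Phi> UNIV K_minus_one \<and>
    (\<forall>l m. \<Phi> (l + m) = (\<lambda>x b. \<Phi> l x b + \<Phi> m x b)) \<and>
    (\<forall>a l. \<Phi> (scale a l) = (\<lambda>x. K_scale a (\<Phi> l x))) \<and>
    \<Phi> ` V = V_perp)"

text \<open>The homogeneous ideal of $\Gamma$, generated by the forms $F$ with \<open>F(s) = 0\<close>.\<close>

definition homogeneous_ideal :: "('n, 'k) mpoly set"
  where "homogeneous_ideal = module.span (*) {F. \<exists>d. form d F \<and>
    (\<forall>\<xi>. module_hom scale (*) \<xi> \<longrightarrow> poly_value \<iota> F (\<xi> \<circ> s) = 0)}"

text \<open>$\Gamma$ has codimension \<open>r = CARD('n) - 1\<close>.\<close>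

definition complete_intersection :: "('n, 'k) mpoly list \<Rightarrow> bool"
  where "complete_intersection Fs \<longleftrightarrow>
    length Fs + 1 = CARD('n) \<and> homogeneous_ideal = module.span (*) (set Fs)"

end

end

theory Submission
  imports Defs "HOL-Analysis.Cartesian_Space" "HOL-Analysis.Product_Vector"
begin

text \<open>
  A line bundle on \<open>\<Gamma> = Spec A\<close> is trivial, so the coordinates become three elements
  \<open>a = (x, y, z)\<close> of \<open>A\<close> generating the unit ideal, and \<open>\<Gamma>\<close> is self-associated iff some functional
  \<open>\<phi>\<close> on \<open>A\<close> is such that \<open>(f, g) \<mapsto> \<phi> (f g)\<close> is perfect and the span \<open>V\<close> of \<open>x, y, z\<close> is its own
  orthogonal. Let \<open>W\<^sub>d\<close> be the space of values at \<open>a\<close> of the forms of degree \<open>d\<close>. The ideal of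
  \<open>\<Gamma>\<close> has as many minimal generators in degree \<open>d + 1\<close> as there are triples in \<open>W\<^sub>d\<close> orthogonal to
  \<open>a\<close>, modulo the Koszul relations \<open>a \<times> t\<close> with \<open>t\<close> in \<open>W\<^bsub>d - 1\<^esub>\<close>. Over \<open>A\<close> the Koszul complex is
  exact, so all depends on whether \<open>t\<close> can be corrected to lie in \<open>W\<^bsub>d - 1\<^esub>\<close> by a multiple of \<open>a\<close>.

  If \<open>V\<close> is its own orthogonal then \<open>dim A = 6\<close>, and the orthogonal of \<open>W\<^sub>2\<close> consists of the
  \<open>b\<close> with \<open>b V \<subseteq> V\<close>. Such a \<open>b\<close> is a scalar, hence \<open>W\<^sub>2 = ker \<phi>\<close> and \<open>W\<^sub>3 = A\<close>. This leaves one
  generator in each of the degrees 2 and 3, and none in degree 4 since \<open>h \<mapsto> \<phi> (h a)\<close> maps onto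
  triples of scalars. Conversely, generation by a conic and a cubic makes the Hilbert function
  \<open>d \<mapsto> dim W\<^sub>d\<close> convex enough to be \<open>1, 3, 5, 6, 6, \<dots>\<close>; the functional \<open>\<phi>\<close> with kernel \<open>W\<^sub>2\<close> then
  works, by the absence of generators in degree 4.
\<close>

section \<open>Forms in three variables\<close>

lemma poly_mapping_eq_sum_monomials:
  fixes P :: "'m \<Rightarrow>\<^sub>0 'k::comm_monoid_add"
  shows "P = (\<Sum>m\<in>Poly_Mapping.keys P. Poly_Mapping.single m (Poly_Mapping.lookup P m))"
  by (rule poly_mapping_eqI)
    (simp add: lookup_sum lookup_single when_def in_keys_iff if_distrib cong: if_cong)

lemma poly_mapping_monomial_induct [case_names single add]:
  fixes P :: "('m \<Rightarrow>\<^sub>0 'k::comm_monoid_add)"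
  assumes "\<And>m c. Q (Poly_Mapping.single m c)" and "\<And>F G. Q F \<Longrightarrow> Q G \<Longrightarrow> Q (F + G)"
  shows "Q P"
proof -
  have "Q (\<Sum>m\<in>A. Poly_Mapping.single m (Poly_Mapping.lookup P m))" if "finite A" for A
    using that
  proof induction
    case empty
    show ?case using assms(1)[of undefined 0] by simp
  next
    case (insert m A)
    then show ?case using assms by simp
  qed
  from this[OF finite_keys, of P] show ?thesis
    unfolding poly_mapping_eq_sum_monomials[of P, symmetric] .
qed

definition mdeg :: "('n::finite \<Rightarrow>\<^sub>0 nat) \<Rightarrow> nat"
  where "mdeg m = (\<Sum>i\<in>UNIV. Poly_Mapping.lookup m i)"

lemma mdeg_add: "mdeg (m + m') = mdeg m + mdeg m'"
  by (simp add: mdeg_def lookup_add sum.distrib)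

lemma mdeg_single [simp]: "mdeg (Poly_Mapping.single i e) = e"
  by (simp add: mdeg_def lookup_single when_def)

lemma mdeg_zero [simp]: "mdeg 0 = 0"
  by (simp add: mdeg_def)

lemma mdeg_eq_0_iff: "mdeg m = 0 \<longleftrightarrow> m = 0"
  by (auto simp: mdeg_def intro: poly_mapping_eqI)

lemma form_iff: "form d F \<longleftrightarrow> (\<forall>m. Poly_Mapping.lookup F m \<noteq> 0 \<longrightarrow> mdeg m = d)"
  by (auto simp: form_def mdeg_def in_keys_iff)

lemma form_zero [simp]: "form d 0"
  by (simp add: form_iff)

lemma form_add: "form d F \<Longrightarrow> form d G \<Longrightarrow> form d (F + G)"
  for F :: "('n::finite, 'k::ab_group_add) mpoly"
  by (simp add: form_iff lookup_add) (metis add_0)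

lemma form_uminus: "form d F \<Longrightarrow> form d (- F)"
  for F :: "('n::finite, 'k::ab_group_add) mpoly"
  by (simp add: form_iff)

lemma form_diff: "form d F \<Longrightarrow> form d G \<Longrightarrow> form d (F - G)"
  for F :: "('n::finite, 'k::ab_group_add) mpoly"
  using form_add[of d F "- G"] by (simp add: form_uminus)

lemma form_single: "mdeg m = d \<Longrightarrow> form d (Poly_Mapping.single m c)"
  by (auto simp: form_iff lookup_single when_def)

lemma form_const: "form 0 (Poly_Mapping.single 0 c)"
  by (simp add: form_single)

lemma form_mult: "form d F \<Longrightarrow> form e G \<Longrightarrow> form (d + e) (F * G)"
  for F :: "('n::finite, 'k::comm_ring_1) mpoly"
  using keys_mult[of F G] unfolding form_def mdeg_def[symmetric]
  by (fastforce simp: mdeg_add)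

lemma form_0D:
  assumes "form 0 F"
  obtains c where "F = Poly_Mapping.single 0 c"
proof -
  have "F = Poly_Mapping.single 0 (Poly_Mapping.lookup F 0)"
    using assms by (intro poly_mapping_eqI) (auto simp: form_iff mdeg_eq_0_iff lookup_single when_def)
  then show thesis using that by blast
qed

definition var :: "'n \<Rightarrow> ('n, 'k::comm_ring_1) mpoly"
  where "var i = Poly_Mapping.single (Poly_Mapping.single i 1) 1"

lemma form_var: "form 1 (var i)"
  by (simp add: var_def form_single)

lemma form_var_mult: "form d F \<Longrightarrow> form (Suc d) (var i * F)"
  using form_mult[OF form_var, of d F i] by simp

lemma inj_add_single: "inj (\<lambda>m. m + t)" for t :: "'n \<Rightarrow>\<^sub>0 nat"
  by (simp add: inj_on_def)

text \<open>The monomials not divisible by the variable are dropped.\<close>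

definition vquot :: "'n \<Rightarrow> ('n, 'k::comm_ring_1) mpoly \<Rightarrow> ('n, 'k) mpoly"
  where "vquot i F = Poly_Mapping.map_key (\<lambda>m. m + Poly_Mapping.single i 1) F"

lemma lookup_vquot: "Poly_Mapping.lookup (vquot i F) m = Poly_Mapping.lookup F (m + Poly_Mapping.single i 1)"
  unfolding vquot_def by (simp add: map_key.rep_eq[OF inj_add_single])

lemma vquot_add: "vquot i (F + G) = vquot i F + vquot i G"
  by (rule poly_mapping_eqI) (simp add: lookup_vquot lookup_add)

lemma vquot_zero [simp]: "vquot i 0 = 0"
  by (rule poly_mapping_eqI) (simp add: lookup_vquot)

lemma form_vquot: "form d F \<Longrightarrow> form (d - 1) (vquot i F)"
  by (fastforce simp: form_iff lookup_vquot mdeg_add)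

lemma vquot_single_add: "vquot i (Poly_Mapping.single (m + Poly_Mapping.single i 1) c) = Poly_Mapping.single m c"
  by (rule poly_mapping_eqI) (simp add: lookup_vquot lookup_single when_def)

lemma vquot_single_zero:
  assumes "Poly_Mapping.lookup m i = 0"
  shows "vquot i (Poly_Mapping.single m c) = 0"
proof (rule poly_mapping_eqI)
  fix l
  have "m \<noteq> l + Poly_Mapping.single i 1"
    using assms by (metis add_is_0 lookup_add lookup_single_eq one_neq_zero)
  then show "Poly_Mapping.lookup (vquot i (Poly_Mapping.single m c)) l = Poly_Mapping.lookup 0 l"
    by (simp add: lookup_vquot lookup_single when_def)
qed

lemma monomial_split:
  fixes m :: "'n \<Rightarrow>\<^sub>0 nat"
  assumes "Poly_Mapping.lookup m i \<noteq> 0"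
  obtains m' where "m = m' + Poly_Mapping.single i 1"
proof
  show "m = (m - Poly_Mapping.single i 1) + Poly_Mapping.single i 1"
    using assms by (intro poly_mapping_eqI) (auto simp: lookup_add lookup_minus lookup_single when_def)
qed

lemma var_mult_single: "var i * Poly_Mapping.single m c = Poly_Mapping.single (m + Poly_Mapping.single i 1) c"
  by (simp add: var_def mult_single add.commute)

lemma vquot_var_mult [simp]: "vquot i (var i * F) = F"
  by (induction F rule: poly_mapping_monomial_induct)
    (simp_all only: var_mult_single vquot_single_add distrib_left vquot_add)

lemma vquot_var_mult_other:
  assumes "j \<noteq> i"
  shows "vquot i (var j * F) = var j * vquot i F"
proof (induction F rule: poly_mapping_monomial_induct)
  case (single m c)
  show ?case
  proof (cases "Poly_Mapping.lookup m i = 0")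
    case True
    with assms show ?thesis
      by (simp add: var_mult_single vquot_single_zero lookup_add lookup_single)
  next
    case False
    then obtain m' where m: "m = m' + Poly_Mapping.single i 1" by (rule monomial_split)
    have "var j * Poly_Mapping.single m c =
        Poly_Mapping.single ((m' + Poly_Mapping.single j 1) + Poly_Mapping.single i 1) c"
      by (simp only: var_mult_single m add.commute add.left_commute)
    then show ?thesis by (simp only: m vquot_single_add var_mult_single)
  qed
next
  case (add F G)
  then show ?case by (simp add: distrib_left vquot_add)
qed

text \<open>Division by \<open>var 0\<close> expresses \<open>P\<close> through \<open>var 1\<close>
  and \<open>var 2\<close>. Once the Koszul relations found in this way are subtracted, a relation
  between \<open>var 1\<close> and \<open>var 2\<close> alone is left, and division by
  \<open>var 1\<close> settles it. The explicit quotients keep track of degrees.\<close>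

lemma koszul_poly:
  fixes P Q R :: "(3, 'k::comm_ring_1) mpoly"
  assumes eq: "var 0 * P + var 1 * Q + var 2 * R = 0"
    and forms: "form d P" "form d Q" "form d R"
  obtains A B C where "form (d - 1) A" "form (d - 1) B" "form (d - 1) C"
    "P = var 1 * C - var 2 * B" "Q = var 2 * A - var 0 * C" "R = var 0 * B - var 1 * A"
proof -
  have ne: "(0::3) \<noteq> 1" "(0::3) \<noteq> 2" "(1::3) \<noteq> 2" by simp_all
  define X Y Z :: "(3, 'k) mpoly" where "X = var 0" and "Y = var 1" and "Z = var 2"
  note e = eq[folded X_def Y_def Z_def]
  have vX: "vquot 0 (X * F) = F" "vquot 1 (X * F) = X * vquot 1 F" "vquot 2 (X * F) = X * vquot 2 F"
    and vY: "vquot 1 (Y * F) = F" "vquot 0 (Y * F) = Y * vquot 0 F" "vquot 2 (Y * F) = Y * vquot 2 F"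
    and vZ: "vquot 2 (Z * F) = F" "vquot 0 (Z * F) = Z * vquot 0 F" "vquot 1 (Z * F) = Z * vquot 1 F"
    for F unfolding X_def Y_def Z_def using ne ne[symmetric] by (simp_all add: vquot_var_mult_other)
  define B C where "B = vquot 0 R" and "C = - vquot 0 Q"
  define Q' R' where "Q' = Q + X * C" and "R' = R - X * B"
  define A where "A = - vquot 1 R'"
  have P: "P = Y * C - Z * B"
  proof -
    have "P + Y * vquot 0 Q + Z * vquot 0 R = 0"
      using arg_cong[OF e, of "vquot 0"] by (simp add: vquot_add vX vY vZ)
    then show ?thesis
      by (simp add: B_def C_def eq_diff_eq eq_neg_iff_add_eq_0 add_ac)
  qed
  have QR: "Y * Q' + Z * R' = 0"
  proof -
    have "Y * Q' + Z * R' = X * P + Y * Q + Z * R"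
      unfolding P Q'_def R'_def by (simp add: algebra_simps)
    then show ?thesis using e by simp
  qed
  have Q': "Q' = Z * A"
    using arg_cong[OF QR, of "vquot 1"] by (simp add: vquot_add vY vZ A_def add_eq_0_iff)
  have "Z * (R' + Y * A) = 0"
    using QR unfolding Q' by (simp add: algebra_simps)
  then have R': "R' + Y * A = 0"
    using vZ(1)[of "R' + Y * A"] by simp
  show thesis
  proof (rule that[of A B C])
    show "form (d - 1) B" "form (d - 1) C"
      using forms unfolding B_def C_def by (blast intro: form_vquot form_uminus)+
    \<comment> \<open>For \<open>d = 0\<close> the truncated \<open>d - 1\<close> is again
      \<open>0\<close>, and degrees alone do not suffice; but then \<open>R\<close> is constant and
      its quotient \<open>B\<close> is zero.\<close>
    then have "form d R'"
    proof (cases d)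
      case 0
      then have "vquot 0 R = 0"
      proof -
        obtain c where "R = Poly_Mapping.single 0 c" using forms(3) 0 form_0D by blast
        then show ?thesis by (simp add: vquot_single_zero)
      qed
      then show ?thesis using forms(3) by (simp add: R'_def B_def)
    next
      case (Suc e)
      then show ?thesis unfolding R'_def X_def
        using forms(3) \<open>form (d - 1) B\<close> by (intro form_diff) (auto intro: form_var_mult)
    qed
    then show "form (d - 1) A" unfolding A_def by (blast intro: form_vquot form_uminus)
    show "P = var 1 * C - var 2 * B" using P by (simp add: Y_def Z_def)
    show "Q = var 2 * A - var 0 * C"
      using Q' unfolding Q'_def Z_def[symmetric] X_def[symmetric] by (simp add: eq_diff_eq)
    show "R = var 0 * B - var 1 * A"
    proof -
      have "R + Y * A = X * B + (R' + Y * A)" by (simp add: R'_def)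
      then show ?thesis using R' by (simp add: eq_diff_eq X_def Y_def)
    qed
  qed
qed

lemma form_decompose:
  fixes F :: "(3, 'k::comm_ring_1) mpoly"
  assumes "form (Suc d) F"
  obtains A B C where "form d A" "form d B" "form d C" "F = var 0 * A + var 1 * B + var 2 * C"
proof -
  have "\<exists>A B C. form d A \<and> form d B \<and> form d C \<and> G = var 0 * A + var 1 * B + var 2 * C"
    if "finite S" "G = (\<Sum>m\<in>S. Poly_Mapping.single m (f m))" "\<forall>m\<in>S. mdeg m = Suc d" for G :: "(3, 'k) mpoly" and f S
    using that
  proof (induction S arbitrary: G)
    case empty
    then show ?case by (intro exI[of _ 0]) simp
  next
    case (insert m S)
    then obtain A B C where ABC: "form d A" "form d B" "form d C"
      "(\<Sum>m\<in>S. Poly_Mapping.single m (f m)) = var 0 * A + var 1 * B + var 2 * C" by blast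
    have "mdeg m \<noteq> 0" using insert.prems by simp
    then obtain i where i: "Poly_Mapping.lookup m i \<noteq> 0" by (auto simp: mdeg_def)
    then obtain m' where m': "m = m' + Poly_Mapping.single i 1" by (rule monomial_split)
    define M where "M = Poly_Mapping.single m' (f m)"
    have M: "form d M" "Poly_Mapping.single m (f m) = var i * M"
      using insert.prems by (auto simp: M_def m' mdeg_add var_mult_single intro: form_single)
    have G: "G = var i * M + (var 0 * A + var 1 * B + var 2 * C)"
      unfolding insert.prems(1) sum.insert[OF insert.hyps] ABC(4) M(2) ..
    consider "i = 0" | "i = 1" | "i = 2" using exhaust_3[of i] by auto
    then show ?case
    proof cases
      case 1
      then have "G = var 0 * (M + A) + var 1 * B + var 2 * C" by (simp add: G algebra_simps)
      then show ?thesis using ABC M(1) form_add by blast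
    next
      case 2
      then have "G = var 0 * A + var 1 * (M + B) + var 2 * C" by (simp add: G algebra_simps)
      then show ?thesis using ABC M(1) form_add by blast
    next
      case 3
      then have "G = var 0 * A + var 1 * B + var 2 * (M + C)" by (simp add: G algebra_simps)
      then show ?thesis using ABC M(1) form_add by blast
    qed
  qed
  from this[OF finite_keys poly_mapping_eq_sum_monomials[of F]] show thesis
    using assms that by (auto simp: form_iff in_keys_iff)
qed

definition hcomp :: "nat \<Rightarrow> ('n::finite, 'k::comm_ring_1) mpoly \<Rightarrow> ('n, 'k) mpoly"
  where "hcomp d F = Poly_Mapping.mapp (\<lambda>m c. c when mdeg m = d) F"

lemma lookup_hcomp: "Poly_Mapping.lookup (hcomp d F) m = (Poly_Mapping.lookup F m when mdeg m = d)"
  by (auto simp: hcomp_def lookup_mapp when_def in_keys_iff)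

lemma hcomp_add: "hcomp d (F + G) = hcomp d F + hcomp d G"
  by (rule poly_mapping_eqI) (simp add: lookup_hcomp lookup_add when_def)

lemma form_hcomp: "form d (hcomp d F)"
  by (simp add: form_iff lookup_hcomp)

lemma hcomp_form: "form e F \<Longrightarrow> hcomp d F = (if d = e then F else 0)"
  by (rule poly_mapping_eqI) (auto simp: lookup_hcomp form_iff when_def)

lemma hcomp_mult:
  assumes "form e q"
  shows "hcomp d (F * q) = (if d < e then 0 else hcomp (d - e) F * q)"
proof (induction F rule: poly_mapping_monomial_induct)
  case (single m c)
  have "form (mdeg m + e) (Poly_Mapping.single m c * q)"
    using form_mult[OF form_single[OF refl] assms] .
  then have "hcomp d (Poly_Mapping.single m c * q)
      = (if d = mdeg m + e then Poly_Mapping.single m c * q else 0)" by (rule hcomp_form)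
  then show ?case using hcomp_form[OF form_single[OF refl], of "d - e" m c] by auto
next
  case (add F G)
  then show ?case by (simp add: distrib_right hcomp_add)
qed

section \<open>Evaluation of polynomials in an algebra over a field\<close>

locale scalar_hom =
  fixes \<iota> :: "'k::field \<Rightarrow> 'a::comm_ring_1"
  assumes \<iota>_one: "\<iota> 1 = 1"
    and \<iota>_add: "\<iota> (c + d) = \<iota> c + \<iota> d"
    and \<iota>_mult: "\<iota> (c * d) = \<iota> c * \<iota> d"
begin

lemma \<iota>_zero [simp]: "\<iota> 0 = 0"
  using \<iota>_add[of 0 0] by simp

lemma poly_value_single [simp]:
  "poly_value \<iota> (Poly_Mapping.single m c) x = \<iota> c * (\<Prod>i\<in>UNIV. x i ^ Poly_Mapping.lookup m i)"
  by (simp add: poly_value_def)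

lemma poly_value_zero [simp]: "poly_value \<iota> 0 x = 0"
  by (simp add: poly_value_def)

lemma poly_value_superset:
  assumes "finite S" "Poly_Mapping.keys F \<subseteq> S"
  shows "poly_value \<iota> F x = (\<Sum>m\<in>S. \<iota> (Poly_Mapping.lookup F m) * (\<Prod>i\<in>UNIV. x i ^ Poly_Mapping.lookup m i))"
  unfolding poly_value_def using assms
  by (intro sum.mono_neutral_left) (auto simp: in_keys_iff)

lemma poly_value_add: "poly_value \<iota> (F + G) x = poly_value \<iota> F x + poly_value \<iota> G x"
proof -
  let ?S = "Poly_Mapping.keys F \<union> Poly_Mapping.keys G"
  have "Poly_Mapping.keys (F + G) \<subseteq> ?S" by (rule keys_add)
  then show ?thesis
    by (simp add: poly_value_superset[of ?S] lookup_add \<iota>_add distrib_right sum.distrib)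
qed

lemma poly_value_mult: "poly_value \<iota> (F * G) x = poly_value \<iota> F x * poly_value \<iota> G x"
proof (induction F rule: poly_mapping_monomial_induct)
  case (single m c)
  show ?case
  proof (induction G rule: poly_mapping_monomial_induct)
    case (single n d)
    show ?case
      by (simp add: mult_single lookup_add power_add prod.distrib \<iota>_mult algebra_simps)
  qed (simp add: distrib_left poly_value_add)
qed (simp add: distrib_right poly_value_add)

lemma poly_value_uminus: "poly_value \<iota> (- F) x = - poly_value \<iota> F x"
  using poly_value_add[of F "- F" x] by (simp add: eq_neg_iff_add_eq_0 add.commute)

lemma poly_value_diff: "poly_value \<iota> (F - G) x = poly_value \<iota> F x - poly_value \<iota> G x"
  using poly_value_add[of F "- G" x] by (simp add: poly_value_uminus)

lemma poly_value_var [simp]: "poly_value \<iota> (var i) x = x i"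
proof -
  have "(\<Prod>j\<in>UNIV. x j ^ Poly_Mapping.lookup (Poly_Mapping.single i (1::nat)) j) = (\<Prod>j\<in>UNIV. if i = j then x j else 1)"
    by (intro prod.cong) (auto simp: lookup_single when_def)
  then show ?thesis by (simp add: var_def \<iota>_one)
qed

lemma poly_value_scale:
  assumes "form d F"
  shows "poly_value \<iota> F (\<lambda>i. t * x i) = t ^ d * poly_value \<iota> F x"
proof -
  have "(\<Prod>i\<in>UNIV. (t * x i) ^ Poly_Mapping.lookup m i) = t ^ mdeg m * (\<Prod>i\<in>UNIV. x i ^ Poly_Mapping.lookup m i)" for m
    by (simp add: power_mult_distrib prod.distrib mdeg_def power_sum)
  then show ?thesis using assms
    by (auto simp: poly_value_def form_iff in_keys_iff sum_distrib_left algebra_simps intro!: sum.cong)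
qed

end

section \<open>Linear algebra\<close>

lemma (in finite_dimensional_vector_space_pair_1) rank_nullity:
  assumes lin: "Vector_Spaces.linear s1 s2 f" and S: "vs1.subspace S"
  shows "vs1.dim S = vs2.dim (f ` S) + vs1.dim {x \<in> S. f x = 0}"
proof -
  interpret f: Vector_Spaces.linear s1 s2 f by fact
  let ?K = "{x \<in> S. f x = 0}"
  obtain C where C: "C \<subseteq> ?K" "vs1.independent C" "?K \<subseteq> vs1.span C"
    using vs1.maximal_independent_subset by blast
  have "C \<subseteq> S" using C(1) by blast
  from vs1.maximal_independent_subset_extend[OF this C(2)]
  obtain B where B: "C \<subseteq> B" "B \<subseteq> S" "vs1.independent B" "S \<subseteq> vs1.span B" .
  have fin: "finite B" using B(3) vs1.finiteI_independent by blast
  have indD: "vs1.independent (B - C)" using B(3) vs1.independent_mono by blast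
  have B_eq: "vs1.span B = {u + v |u v. u \<in> vs1.span C \<and> v \<in> vs1.span (B - C)}"
    unfolding vs1.span_Un[symmetric] using B(1) by (simp add: Un_absorb1)
  have "vs1.dim (vs1.span B) + vs1.dim (vs1.span C \<inter> vs1.span (B - C))
      = vs1.dim (vs1.span C) + vs1.dim (vs1.span (B - C))"
    unfolding B_eq by (rule vs1.dim_sums_Int) (rule vs1.subspace_span)+
  moreover have "vs1.dim (vs1.span B) = card B" "vs1.dim (vs1.span C) = card C"
    "vs1.dim (vs1.span (B - C)) = card (B - C)"
    by (rule vs1.dim_span_eq_card_independent, fact)+
  moreover have card: "card B = card (B - C) + card C"
    using card_Diff_subset[OF finite_subset[OF B(1) fin] B(1)] card_mono[OF fin B(1)] by simp
  ultimately have "vs1.dim (vs1.span C \<inter> vs1.span (B - C)) = 0" by linarith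
  then have int: "vs1.span C \<inter> vs1.span (B - C) \<subseteq> {0}" by simp
  have inS: "vs1.span (B - C) \<subseteq> S"
    using B(2) by (intro vs1.span_minimal S) auto
  have inj: "inj_on f (vs1.span (B - C))"
    unfolding f.inj_on_iff_eq_0[OF vs1.subspace_span]
  proof (intro ballI impI)
    fix v assume v: "v \<in> vs1.span (B - C)" and "f v = 0"
    then have "v \<in> vs1.span C" using inS C(3) by blast
    then show "v = 0" using v int by blast
  qed
  have "f ` S = f ` vs1.span (B - C)"
  proof
    show "f ` vs1.span (B - C) \<subseteq> f ` S" using inS by blast
    have "B \<subseteq> C \<union> (B - C)" by blast
    then have "S \<subseteq> vs1.span (C \<union> (B - C))"
      using B(4) vs1.span_mono by blast
    then have "f ` S \<subseteq> vs2.span (f ` (C \<union> (B - C)))" by (rule f.spans_image)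
    also have "\<dots> \<subseteq> vs2.span (insert 0 (f ` (B - C)))"
      using C(1) by (intro vs2.span_mono) auto
    finally show "f ` S \<subseteq> f ` vs1.span (B - C)" by (simp add: f.span_image)
  qed
  then have "vs2.dim (f ` S) = card (B - C)"
    using dim_image_eq[OF lin, of "vs1.span (B - C)"] inj vs1.dim_span_eq_card_independent[OF indD]
    by (simp add: vs1.span_span)
  moreover have "vs1.dim S = card B"
    using vs1.basis_card_eq_dim[OF B(2,4,3)] by simp
  moreover have "vs1.dim ?K = card C"
    using vs1.basis_card_eq_dim[OF C(1,3,2)] by simp
  ultimately show ?thesis using card by linarith
qed

text \<open>For picking a single new generator: \<open>T\<close> will be all relations in some
  degree and \<open>S\<close> the Koszul ones, so that \<open>t\<close> spans the quotient.\<close>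

lemma (in finite_dimensional_vector_space) codim_one:
  assumes S: "subspace S" and T: "subspace T" and "S \<subseteq> T" and dim: "dim T = Suc (dim S)"
  obtains t where "t \<in> T" "t \<notin> S" "\<And>u. u \<in> T \<Longrightarrow> \<exists>r. u - scale r t \<in> S"
proof -
  have "S \<noteq> T" using dim by auto
  with \<open>S \<subseteq> T\<close> obtain t where t: "t \<in> T" "t \<notin> S" by blast
  have "span (insert t S) \<subseteq> T" using t(1) \<open>S \<subseteq> T\<close> by (intro span_minimal T) auto
  moreover have "dim (span (insert t S)) = dim T"
    using t(2) dim S by (simp add: dim_insert span_eq_iff[THEN iffD2])
  ultimately have "span (insert t S) = T"
    by (intro subspace_dim_equal subspace_span T) auto
  then have "\<exists>r. u - scale r t \<in> S" if "u \<in> T" for u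
    using that S by (auto simp: span_insert span_eq_iff[THEN iffD2])
  with t that show thesis by blast
qed

lemma (in finite_dimensional_vector_space) dim_le_Suc:
  assumes "\<And>u. u \<in> T \<Longrightarrow> \<exists>r. u - scale r t \<in> S"
  shows "dim T \<le> Suc (dim S)"
proof -
  have "T \<subseteq> span (insert t S)"
    using assms span_base by (fastforce simp: span_insert)
  then have "dim T \<le> dim (insert t S)" by (rule dim_mono)
  also have "\<dots> \<le> Suc (dim S)" by (simp add: dim_insert)
  finally show ?thesis .
qed

lemma (in vector_space) separating_functional:
  assumes S: "subspace S" and t: "t \<notin> S"
  obtains \<phi> where "Vector_Spaces.linear scale (*) \<phi>" "\<And>u. u \<in> S \<Longrightarrow> \<phi> u = 0" "\<phi> t = 1"
proof -
  interpret fld: vector_space "(*) :: 'a \<Rightarrow> 'a \<Rightarrow> 'a" by unfold_locales (simp_all add: algebra_simps)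
  interpret p: vector_space_pair scale "(*) :: 'a \<Rightarrow> 'a \<Rightarrow> 'a" by unfold_locales
  obtain B where B: "B \<subseteq> S" "independent B" "S \<subseteq> span B"
    using maximal_independent_subset by blast
  have "span B = S" using B S by (metis span_subspace)
  then have "independent (insert t B)" using B(2) t independent_insertI by blast
  then obtain \<phi> where \<phi>: "Vector_Spaces.linear scale (*) \<phi>" "\<forall>u\<in>insert t B. \<phi> u = (if u = t then 1 else 0)"
    using p.linear_independent_extend[of "insert t B" "\<lambda>u. if u = t then 1 else 0"] by blast
  interpret \<phi>: Vector_Spaces.linear scale "(*)" \<phi> by fact
  have "\<phi> u = 0" if "u \<in> S" for u
  proof (rule \<phi>.eq_0_on_span)
    show "u \<in> span B" using B(3) that by blast
    show "\<phi> v = 0" if "v \<in> B" for v using \<phi>(2) B(1) t that by auto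
  qed
  then show thesis using \<phi> that by simp
qed

text \<open>\<open>T u\<close> has the values of \<open>\<beta> u\<close> on the basis as its
  coordinates. Nondegeneracy makes \<open>T\<close> injective, finite dimension makes it surjective,
  and a preimage of the vector with coordinates \<open>\<psi> b\<close> represents
  \<open>\<psi>\<close>.\<close>

lemma (in finite_dimensional_vector_space) riesz_representation:
  fixes \<beta> :: "'b \<Rightarrow> 'b \<Rightarrow> 'a"
  assumes l1: "\<And>u. Vector_Spaces.linear scale (*) (\<beta> u)"
    and l2: "\<And>v. Vector_Spaces.linear scale (*) (\<lambda>u. \<beta> u v)"
    and nondeg: "\<And>u. (\<And>v. \<beta> u v = 0) \<Longrightarrow> u = 0"
    and \<psi>: "Vector_Spaces.linear scale (*) \<psi>"
  obtains h where "\<psi> = \<beta> h"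
proof -
  define T where "T u = (\<Sum>b\<in>Basis. scale (\<beta> u b) b)" for u
  have lin: "Vector_Spaces.linear scale scale T"
  proof -
    have add: "\<beta> (u + u') v = \<beta> u v + \<beta> u' v" and scl: "\<beta> (scale c u) v = c * \<beta> u v" for u u' c v
    proof -
      interpret l: Vector_Spaces.linear scale "(*)" "\<lambda>u. \<beta> u v" by (rule l2)
      show "\<beta> (u + u') v = \<beta> u v + \<beta> u' v" "\<beta> (scale c u) v = c * \<beta> u v"
        by (rule l.add l.scale)+
    qed
    show ?thesis
      by unfold_locales (simp_all add: T_def add scl scale_left_distrib sum.distrib scale_sum_right)
  qed
  have coeff: "f b = g b" if "(\<Sum>b\<in>Basis. scale (f b) b) = (\<Sum>b\<in>Basis. scale (g b) b)" "b \<in> Basis" for f g b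
  proof -
    have "(\<Sum>b\<in>Basis. scale ((f b - g b)) b) = 0"
      using that(1) by (simp add: scale_left_diff_distrib sum_subtractf)
    then have "f b - g b = 0"
      by (rule independentD[OF independent_Basis finite_Basis order_refl _ that(2)])
    then show ?thesis by simp
  qed
  have ext: "\<gamma> = \<delta>" if "Vector_Spaces.linear scale (*) \<gamma>" "Vector_Spaces.linear scale (*) \<delta>"
    "\<And>b. b \<in> Basis \<Longrightarrow> \<gamma> b = \<delta> b" for \<gamma> \<delta>
  proof
    fix u
    interpret \<gamma>: Vector_Spaces.linear scale "(*)" \<gamma> by fact
    interpret \<delta>: Vector_Spaces.linear scale "(*)" \<delta> by fact
    interpret p: vector_space_pair scale "(*) :: 'a \<Rightarrow> 'a \<Rightarrow> 'a" by unfold_locales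
    show "\<gamma> u = \<delta> u"
      using p.linear_eq_on[OF that(1,2), of u Basis] that(3) by (simp add: span_Basis)
  qed
  have "inj T"
  proof -
    interpret T: Vector_Spaces.linear scale scale T by fact
    have "u = 0" if "T u = 0" for u
    proof (rule nondeg)
      interpret b: Vector_Spaces.linear scale "(*)" "\<beta> u" by (rule l1)
      have "\<beta> u b = 0" if "b \<in> Basis" for b
        using coeff[of "\<beta> u" "\<lambda>_. 0" b] \<open>T u = 0\<close> that by (simp add: T_def)
      then show "\<beta> u v = 0" for v
        using b.eq_0_on_span[of Basis v] by (simp add: span_Basis)
    qed
    then show ?thesis by (simp add: T.inj_iff_eq_0)
  qed
  then have "surj T" using linear_inj_imp_surj lin by blast
  then obtain h where "(\<Sum>b\<in>Basis. scale (\<psi> b) b) = T h" by (metis surjD)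
  then have "\<psi> = \<beta> h"
    using coeff[of \<psi> "\<beta> h"] by (intro ext \<psi> l1) (simp add: T_def)
  with that show thesis by blast
qed

section \<open>Finite algebras and triples of coordinates\<close>

locale finite_algebra = scalar_hom \<iota> for \<iota> :: "'k::field \<Rightarrow> 'a::comm_ring_1" +
  assumes finite_dim: "\<exists>B. finite B \<and> module.span (\<lambda>c a. \<iota> c * a) B = UNIV"
begin

abbreviation sc :: "'k \<Rightarrow> 'a \<Rightarrow> 'a" where "sc \<equiv> \<lambda>c a. \<iota> c * a"

sublocale A: vector_space sc
  by unfold_locales (simp_all add: algebra_simps \<iota>_add \<iota>_mult \<iota>_one)

declare A.scale_scale [simp del]

definition Bas :: "'a set"
  where "Bas = (SOME B. finite B \<and> A.independent B \<and> A.span B = UNIV)"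

lemma Bas: "finite Bas \<and> A.independent Bas \<and> A.span Bas = UNIV"
  unfolding Bas_def
proof (rule someI_ex)
  obtain C where C: "finite C" "A.span C = UNIV" using finite_dim by blast
  obtain B where B: "B \<subseteq> C" "A.independent B" "C \<subseteq> A.span B"
    using A.maximal_independent_subset by blast
  have "A.span C \<subseteq> A.span B" using B(3) by (rule A.span_minimal) (rule A.subspace_span)
  then show "\<exists>B. finite B \<and> A.independent B \<and> A.span B = UNIV"
    using B C finite_subset[OF B(1)] by auto
qed

sublocale A: finite_dimensional_vector_space sc Bas
  using Bas by unfold_locales auto

lemma dim_multiples_le: "A.dim ((*) u ` S) \<le> A.dim S"
proof -
  interpret p: finite_dimensional_vector_space_pair sc Bas sc Bas by unfold_locales
  have "Vector_Spaces.linear sc sc ((*) u)"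
    by unfold_locales (simp_all add: algebra_simps)
  then show ?thesis by (rule p.dim_image_le)
qed

end

text \<open>What is left of the scheme after a trivialization of the line bundle: the assumptions
  say that the sections generate it, that the morphism to the plane is a closed immersion, and that
  no nonzero linear form vanishes.\<close>

locale plane_algebra = finite_algebra \<iota> for \<iota> :: "'k::field \<Rightarrow> 'a::comm_ring_1" +
  fixes crd :: "3 \<Rightarrow> 'a"
  assumes unit_ideal: "\<exists>u v w. u * crd 0 + v * crd 1 + w * crd 2 = 1"
    and immersion: "\<exists>d F. form (Suc d) F \<and> poly_value \<iota> F crd = crd i ^ d * l"
    and independent_crd: "\<iota> r * crd 0 + \<iota> s * crd 1 + \<iota> t * crd 2 = 0 \<Longrightarrow> r = 0 \<and> s = 0 \<and> t = 0"
begin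

abbreviation x :: 'a where "x \<equiv> crd 0"
abbreviation y :: 'a where "y \<equiv> crd 1"
abbreviation z :: 'a where "z \<equiv> crd 2"
abbreviation ev :: "(3, 'k) mpoly \<Rightarrow> 'a" where "ev F \<equiv> poly_value \<iota> F crd"

lemmas ev_simps = poly_value_add poly_value_mult poly_value_diff poly_value_uminus poly_value_var

sublocale A2: finite_dimensional_vector_space_prod sc sc Bas Bas
  by unfold_locales

sublocale A3: finite_dimensional_vector_space_prod sc A2.scale Bas A2.Basis_pair
  by unfold_locales

abbreviation cube :: "'a set \<Rightarrow> ('a \<times> 'a \<times> 'a) set" where "cube S \<equiv> S \<times> S \<times> S"

lemma dim_cube: "A.subspace S \<Longrightarrow> A3.p.dim (cube S) = 3 * A.dim S"
  by (simp add: A3.dim_Times A2.dim_Times A2.subspace_Times)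

lemma subspace_cube: "A.subspace S \<Longrightarrow> A3.p.subspace (cube S)"
  by (simp add: A3.subspace_Times A2.subspace_Times)

lemma A3_scale [simp]: "A3.scale r (f, g, h) = (\<iota> r * f, \<iota> r * g, \<iota> r * h)"
  by (simp add: A3.scale_def A2.scale_def)

section \<open>The homogeneous coordinate ring\<close>

definition W :: "nat \<Rightarrow> 'a set" where "W d = {ev F |F. form d F}"

lemma W_I: "form d F \<Longrightarrow> ev F \<in> W d"
  by (auto simp: W_def)

lemma W_E:
  assumes "f \<in> W d" obtains F where "form d F" "f = ev F"
  using assms by (auto simp: W_def)

lemma ev_const [simp]: "ev (Poly_Mapping.single 0 c) = \<iota> c"
  by simp

lemma subspace_W: "A.subspace (W d)"
proof (rule A.subspaceI)
  show "0 \<in> W d" using W_I[OF form_zero] by simp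
  fix f assume f: "f \<in> W d"
  show "f + g \<in> W d" if "g \<in> W d" for g
    using f that by (metis W_E W_I form_add poly_value_add)
  show "\<iota> c * f \<in> W d" for c
  proof -
    obtain F where F: "form d F" "f = ev F" using f by (rule W_E)
    have "form (0 + d) (Poly_Mapping.single 0 c * F)" using F(1) form_const form_mult by blast
    then show ?thesis using W_I[of d "Poly_Mapping.single 0 c * F"] F(2) by (simp add: poly_value_mult)
  qed
qed

lemmas W_add = A.subspace_add[OF subspace_W]
  and W_diff = A.subspace_diff[OF subspace_W]
  and W_scale = A.subspace_scale[OF subspace_W]
  and W_zero [simp] = A.subspace_0[OF subspace_W]

lemma W_0: "W 0 = range \<iota>"
proof
  show "W 0 \<subseteq> range \<iota>" by (auto simp: W_def elim!: form_0D)
  have "\<iota> c \<in> W 0" for c using W_I[OF form_const, of c] by simp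
  then show "range \<iota> \<subseteq> W 0" by blast
qed

lemma W_mult: "f \<in> W d \<Longrightarrow> g \<in> W e \<Longrightarrow> f * g \<in> W (d + e)"
  by (metis W_E W_I form_mult poly_value_mult)

lemma crd_in_W1 [simp]: "crd i \<in> W 1"
  using W_I[OF form_var, of i] by simp

lemma crd_mult_W: "f \<in> W d \<Longrightarrow> crd i * f \<in> W (Suc d)"
  using W_mult[OF crd_in_W1, of f d i] by simp

lemma W_Suc_E:
  assumes "t \<in> W (Suc d)"
  obtains f g h where "f \<in> W d" "g \<in> W d" "h \<in> W d" "t = x * f + y * g + z * h"
proof -
  obtain T where T: "form (Suc d) T" "t = ev T" using assms by (rule W_E)
  obtain F G H where F: "form d F" "form d G" "form d H" "T = var 0 * F + var 1 * G + var 2 * H"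
    using T(1) by (rule form_decompose)
  show thesis by (rule that[of "ev F" "ev G" "ev H"]) (use F T in \<open>simp_all add: W_I ev_simps\<close>)
qed

lemma W_Suc_I: "f \<in> W d \<Longrightarrow> g \<in> W d \<Longrightarrow> h \<in> W d \<Longrightarrow> x * f + y * g + z * h \<in> W (Suc d)"
  by (intro W_add crd_mult_W)

lemma W1_E:
  assumes "v \<in> W 1"
  obtains r s t where "v = \<iota> r * x + \<iota> s * y + \<iota> t * z"
proof -
  have "v \<in> W (Suc 0)" using assms by simp
  then obtain f g h where "f \<in> W 0" "g \<in> W 0" "h \<in> W 0" "v = x * f + y * g + z * h"
    by (rule W_Suc_E)
  then show thesis using that by (auto simp: W_0 mult.commute)
qed

lemma W1_I: "\<iota> r * x + \<iota> s * y + \<iota> t * z \<in> W 1"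
  by (intro W_add W_scale crd_in_W1)

lemma W_Suc_UNIV: "W d = UNIV \<Longrightarrow> W (Suc d) = UNIV"
proof -
  assume W: "W d = UNIV"
  obtain u v w where u: "u * x + v * y + w * z = 1" using unit_ideal by blast
  have "t \<in> W (Suc d)" for t
  proof -
    have "t = x * (u * t) + y * (v * t) + z * (w * t)"
      using u by (metis (no_types, lifting) distrib_right mult.assoc mult.commute mult_1)
    then show ?thesis using W_Suc_I[of "u * t" d "v * t" "w * t"] W by simp
  qed
  then show ?thesis by blast
qed

lemma W_UNIV_mono:
  assumes "d \<le> e" "W d = UNIV" shows "W e = UNIV"
  using assms by (induction rule: dec_induct) (use W_Suc_UNIV in auto)

text \<open>For a single \<open>l\<close> the closed immersion gives an exponent, which can be
  raised on multiplication by \<open>crd i\<close>. The maximum over a finite basis serves all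
  \<open>l\<close> by linearity.\<close>

lemma pow_mult_W_UNIV: "\<exists>D. \<forall>e\<ge>D. \<forall>l. crd i ^ e * l \<in> W (Suc e)"
proof -
  have "\<exists>D. \<forall>b\<in>C. \<forall>e\<ge>D. crd i ^ e * b \<in> W (Suc e)" if "finite C" for C
    using that
  proof induction
    case (insert b C)
    then obtain D where D: "\<forall>b\<in>C. \<forall>e\<ge>D. crd i ^ e * b \<in> W (Suc e)" by blast
    obtain d F where F: "form (Suc d) F" "ev F = crd i ^ d * b" using immersion by blast
    have "crd i ^ (d + n) * b \<in> W (Suc (d + n))" for n
    proof (induction n)
      case 0
      then show ?case using F by (metis W_I add_0_right)
    next
      case (Suc n)
      then show ?case using crd_mult_W[of "crd i ^ (d + n) * b" "Suc (d + n)" i] by (simp add: mult.assoc)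
    qed
    then have "\<forall>e\<ge>d. crd i ^ e * b \<in> W (Suc e)" by (metis le_iff_add)
    then show ?case using D by (intro exI[of _ "max d D"]) auto
  qed simp
  then obtain D where D: "\<forall>b\<in>Bas. \<forall>e\<ge>D. crd i ^ e * b \<in> W (Suc e)" using A.finite_Basis by blast
  have "crd i ^ e * l \<in> W (Suc e)" if "e \<ge> D" for e l
  proof -
    have "l \<in> A.span Bas" by (simp add: A.span_Basis)
    then show ?thesis
    proof (induction rule: A.span_induct_alt)
      case base
      then show ?case by simp
    next
      case (step c b l)
      then have "\<iota> c * (crd i ^ e * b) + crd i ^ e * l \<in> W (Suc e)"
        using D that by (intro W_add W_scale) auto
      then show ?case by (simp add: algebra_simps)
    qed
  qed
  then show ?thesis by blast
qed

text \<open>A monomial of degree at least \<open>3 * D\<close> has an exponent at least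
  \<open>D\<close>, so it multiplies the whole algebra into \<open>W\<close> of the next degree.
  Expanding a power of \<open>u * x + v * y + w * z = 1\<close> into such monomials gives the same
  for 1.\<close>

lemma ex_W_UNIV: "\<exists>D. W D = UNIV"
proof -
  have "\<exists>D. \<forall>i. \<forall>e\<ge>D. \<forall>l. crd i ^ e * l \<in> W (Suc e)"
  proof -
    obtain D0 D1 D2 where D012: "\<forall>e\<ge>D0. \<forall>l. x ^ e * l \<in> W (Suc e)" "\<forall>e\<ge>D1. \<forall>l. y ^ e * l \<in> W (Suc e)"
      "\<forall>e\<ge>D2. \<forall>l. z ^ e * l \<in> W (Suc e)"
      using pow_mult_W_UNIV[of 0] pow_mult_W_UNIV[of 1] pow_mult_W_UNIV[of 2] by blast
    have "\<forall>l. crd i ^ e * l \<in> W (Suc e)" if "e \<ge> max D0 (max D1 D2)" for i e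
    proof -
      consider "i = 0" | "i = 1" | "i = 2" using exhaust_3[of i] by auto
      then show ?thesis using D012 that by cases auto
    qed
    then show ?thesis by blast
  qed
  then obtain D where D: "\<And>i e l. e \<ge> D \<Longrightarrow> crd i ^ e * l \<in> W (Suc e)" by blast
  \<comment> \<open>\<open>L n\<close> is an ideal, so if it contains 1 then
    \<open>W (Suc n)\<close> is the whole algebra.\<close>
  define L where "L n = {a. \<forall>l. a * l \<in> W (Suc n)}" for n
  have L_add: "a + b \<in> L n" if "a \<in> L n" "b \<in> L n" for a b n
    using that by (simp add: L_def distrib_right W_add)
  have L_mult: "a * b \<in> L n" if "a \<in> L n" for a b n
    using that by (simp add: L_def mult.assoc)
  have mono: "x ^ i * y ^ j * z ^ k \<in> L (i + j + k)" if "i + j + k \<ge> 3 * D" for i j k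
  proof -
    have pw: "crd i ^ n \<in> W n" for i n
      by (induction n) (use crd_mult_W \<iota>_one W_0 in \<open>auto intro: range_eqI[of _ _ 1]\<close>)
    consider "i \<ge> D" | "j \<ge> D" | "k \<ge> D" using \<open>i + j + k \<ge> 3 * D\<close> by linarith
    then have "x ^ i * y ^ j * z ^ k * l \<in> W (Suc (i + j + k))" for l
    proof cases
      case 1
      have "(x ^ i * l) * (y ^ j * z ^ k) \<in> W (Suc i + (j + k))" by (intro W_mult D pw 1)
      then show ?thesis by (simp add: algebra_simps)
    next
      case 2
      have "(y ^ j * l) * (x ^ i * z ^ k) \<in> W (Suc j + (i + k))" by (intro W_mult D pw 2)
      then show ?thesis by (simp add: algebra_simps)
    next
      case 3
      have "(z ^ k * l) * (x ^ i * y ^ j) \<in> W (Suc k + (i + j))" by (intro W_mult D pw 3)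
      then show ?thesis by (simp add: algebra_simps)
    qed
    then show ?thesis by (simp add: L_def)
  qed
  obtain u v w where u: "u * x + v * y + w * z = 1" using unit_ideal by blast
  have "1 \<in> L (3 * D)"
  proof -
    \<comment> \<open>Induction on the degree \<open>n\<close> still missing from
      \<open>3 * D\<close>: each multiplication by \<open>u * x + v * y + w * z\<close> raises one
      exponent per term, so no multinomial coefficients occur.\<close>
    have step: "x ^ i * y ^ j * z ^ k \<in> L (3 * D)" if "i + j + k + n = 3 * D" for i j k n
      using that
    proof (induction n arbitrary: i j k)
      case 0
      then show ?case using mono[of i j k] by simp
    next
      case (Suc n)
      have "x ^ Suc i * y ^ j * z ^ k * u + x ^ i * y ^ Suc j * z ^ k * v + x ^ i * y ^ j * z ^ Suc k * w \<in> L (3 * D)"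
        by (intro L_add L_mult Suc.IH) (use Suc.prems in auto)
      also have "x ^ Suc i * y ^ j * z ^ k * u + x ^ i * y ^ Suc j * z ^ k * v + x ^ i * y ^ j * z ^ Suc k * w
          = x ^ i * y ^ j * z ^ k * (u * x + v * y + w * z)"
        by (simp add: algebra_simps)
      finally show ?case by (simp add: u)
    qed
    from step[of 0 0 0 "3 * D"] show ?thesis by simp
  qed
  then have "W (Suc (3 * D)) = UNIV" by (auto simp: L_def)
  then show ?thesis by blast
qed

section \<open>The Koszul complex on the coordinates and its graded pieces\<close>

definition cross :: "'a \<times> 'a \<times> 'a \<Rightarrow> 'a \<times> 'a \<times> 'a"
  where "cross = (\<lambda>(f, g, h). (y * h - z * g, z * f - x * h, x * g - y * f))"

definition dot :: "'a \<times> 'a \<times> 'a \<Rightarrow> 'a"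
  where "dot = (\<lambda>(f, g, h). x * f + y * g + z * h)"

lemma linear_cross: "Vector_Spaces.linear A3.scale A3.scale cross"
  by unfold_locales (auto simp: cross_def, auto simp: algebra_simps)

lemma linear_dot: "Vector_Spaces.linear A3.scale sc dot"
  by unfold_locales (auto simp: dot_def, auto simp: algebra_simps)

lemma dot_cross [simp]: "dot (cross t) = 0"
  by (cases t) (simp add: dot_def cross_def algebra_simps)

lemma ann_coordinates:
  assumes "h * x = 0" "h * y = 0" "h * z = 0" shows "h = 0"
proof -
  obtain u v w where u: "u * x + v * y + w * z = 1" using unit_ideal by blast
  have "h = h * (u * x + v * y + w * z)" by (simp add: u)
  also have "\<dots> = u * (h * x) + v * (h * y) + w * (h * z)" by (simp add: algebra_simps)
  finally show ?thesis by (simp add: assms)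
qed

text \<open>\<open>dot\<close> and \<open>cross\<close> are the scalar and the vector product with a
  = (x, y, z). If e = (u, v, w) satisfies a \<cdot> e = 1, then a \<times> (t \<times> e) = (a
  \<cdot> e) t - (a \<cdot> t) e shows that t \<times> e is a preimage of \<open>t\<close>.\<close>

lemma koszul_dot:
  assumes "dot t = 0" shows "t \<in> range cross"
proof -
  obtain u v w where u: "u * x + v * y + w * z = 1" using unit_ideal by blast
  obtain f g h where t: "t = (f, g, h)" by (cases t)
  have d: "x * f + y * g + z * h = 0" using assms by (simp add: t dot_def)
  have "t = cross (g * w - h * v, h * u - f * w, f * v - g * u)"
  proof -
    have "k = (u * x + v * y + w * z) * k - c * (x * f + y * g + z * h)" for k c
      by (simp add: u d)
    from this[of f u] this[of g v] this[of h w]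
    have "f = y * (f * v - g * u) - z * (h * u - f * w)" "g = z * (g * w - h * v) - x * (f * v - g * u)"
      "h = x * (h * u - f * w) - y * (g * w - h * v)" by (simp_all add: algebra_simps)
    then show ?thesis by (simp add: t cross_def)
  qed
  then show ?thesis by blast
qed

text \<open>Likewise e \<times> (a \<times> t) = (e \<cdot> t) a - (e \<cdot> a) t, so that
  \<open>h\<close> is e \<cdot> t.\<close>

lemma koszul_cross:
  assumes "cross t = 0" obtains h where "t = (h * x, h * y, h * z)"
proof -
  obtain u v w where u: "u * x + v * y + w * z = 1" using unit_ideal by blast
  obtain p q r where t: "t = (p, q, r)" by (cases t)
  have d: "y * r - z * q = 0" "z * p - x * r = 0" "x * q - y * p = 0"
    using assms by (simp_all add: t cross_def zero_prod_def)
  have "k = (u * x + v * y + w * z) * k + a * (y * r - z * q) + b * (z * p - x * r) + c * (x * q - y * p)"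
    for k a b c by (simp add: u d)
  from this[of p 0 "- w" v] this[of q w 0 "- u"] this[of r "- v" u 0]
  have "p = (u * p + v * q + w * r) * x" "q = (u * p + v * q + w * r) * y" "r = (u * p + v * q + w * r) * z"
    by (simp_all add: algebra_simps)
  then show thesis using that t by blast
qed

abbreviation H :: "nat \<Rightarrow> nat" where "H d \<equiv> A.dim (W d)"

text \<open>\<open>Rel d\<close> consists of relations in degree \<open>d + 1\<close> of the coordinate ring.\<close>

definition Rel :: "nat \<Rightarrow> ('a \<times> 'a \<times> 'a) set"
  where "Rel d = {t \<in> cube (W d). dot t = 0}"

text \<open>These \<open>h\<close> parametrize the multiples of (x, y, z) with entries in
  \<open>W d\<close>, that is, the kernel of \<open>cross\<close> on triples from
  \<open>W d\<close>.\<close>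

definition colon :: "nat \<Rightarrow> 'a set"
  where "colon d = {h. h * x \<in> W d \<and> h * y \<in> W d \<and> h * z \<in> W d}"

lemma subspace_Rel: "A3.p.subspace (Rel d)"
proof -
  interpret l: Vector_Spaces.linear A3.scale sc dot by (rule linear_dot)
  show ?thesis
    using A3.p.subspace_inter[OF subspace_cube[OF subspace_W] l.subspace_kernel]
    by (simp add: Rel_def Collect_conj_eq)
qed

lemma subspace_cross: "A3.p.subspace (cross ` cube (W d))"
proof -
  interpret l: Vector_Spaces.linear A3.scale A3.scale cross by (rule linear_cross)
  show ?thesis by (rule l.subspace_image[OF subspace_cube[OF subspace_W]])
qed

lemma dim_Rel: "3 * H d = H (Suc d) + A3.p.dim (Rel d)"
proof -
  interpret p: finite_dimensional_vector_space_pair_1 A3.scale A3.Basis_pair sc by unfold_locales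
  have "dot ` cube (W d) = W (Suc d)"
  proof
    show "dot ` cube (W d) \<subseteq> W (Suc d)" by (auto simp: dot_def intro: W_Suc_I)
    show "W (Suc d) \<subseteq> dot ` cube (W d)"
      by (force simp: dot_def image_iff elim!: W_Suc_E)
  qed
  then show ?thesis
    using p.rank_nullity[OF linear_dot subspace_cube[OF subspace_W], of d]
    by (simp add: dim_cube subspace_W Rel_def)
qed

text \<open>Rank-nullity for \<open>cross\<close>, whose kernel is a copy of \<open>colon d\<close>
  by \<open>koszul_cross\<close>.\<close>

lemma dim_cross: "3 * H d = A3.p.dim (cross ` cube (W d)) + A.dim (colon d)"
proof -
  interpret p: finite_dimensional_vector_space_pair_1 A3.scale A3.Basis_pair A3.scale by unfold_locales
  interpret q: finite_dimensional_vector_space_pair_1 sc Bas A3.scale by unfold_locales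
  define \<mu> where "\<mu> h = (h * x, h * y, h * z)" for h
  have lin: "Vector_Spaces.linear sc A3.scale \<mu>"
    by unfold_locales (auto simp: \<mu>_def, auto simp: algebra_simps)
  interpret l: Vector_Spaces.linear sc A3.scale \<mu> by fact
  have "h = 0" if "\<mu> h = 0" for h
  proof -
    have "h * x = 0" "h * y = 0" "h * z = 0" using that by (simp_all add: \<mu>_def zero_prod_def)
    then show "h = 0" by (rule ann_coordinates)
  qed
  then have inj: "inj \<mu>" by (simp add: l.inj_iff_eq_0)
  have "{t \<in> cube (W d). cross t = 0} = \<mu> ` colon d"
  proof
    show "{t \<in> cube (W d). cross t = 0} \<subseteq> \<mu> ` colon d"
      by (force simp: \<mu>_def colon_def elim: koszul_cross)
    show "\<mu> ` colon d \<subseteq> {t \<in> cube (W d). cross t = 0}"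
      by (auto simp: \<mu>_def colon_def cross_def zero_prod_def algebra_simps)
  qed
  moreover have "A3.p.dim (\<mu> ` colon d) = A.dim (colon d)"
    using q.dim_image_eq[OF lin] inj inj_on_subset by blast
  ultimately show ?thesis
    using p.rank_nullity[OF linear_cross subspace_cube[OF subspace_W], of d]
    by (simp add: dim_cube subspace_W)
qed

lemma cross_Rel: "cross ` cube (W d) \<subseteq> Rel (Suc d)"
  unfolding Rel_def using dot_cross
  by (auto simp: cross_def intro!: W_diff crd_mult_W)

lemma dim_W0: "H 0 = 1"
proof -
  have "(1::'a) \<noteq> 0" by simp
  then have "A.independent {1}" by (simp only: A.dependent_single not_False_eq_True)
  moreover have "W 0 = A.span {1}" by (auto simp: W_0 A.span_singleton)
  ultimately show ?thesis by (simp add: A.dim_eq_card_independent)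
qed

lemma \<iota>_in_colon: "\<iota> r \<in> colon 1"
  unfolding colon_def by (intro CollectI conjI W_scale crd_in_W1)

lemma W_colon: "W d \<subseteq> colon (Suc d)"
  by (auto simp: colon_def crd_mult_W mult.commute[of _ "crd _"])

text \<open>If h (x, y, z) is a triple of scalars (r, s, t), then s x = r y, t x = r z and t y = s
  z. Linear independence makes the scalars zero, so that \<open>h\<close> annihilates the unit
  ideal.\<close>

lemma colon_0: "colon 0 = {0}"
proof -
  have "h = 0" if h: "h \<in> colon 0" for h
  proof -
    obtain r s t where e: "h * x = \<iota> r" "h * y = \<iota> s" "h * z = \<iota> t"
      using h by (auto simp: colon_def W_0)
    have "\<iota> s * x + \<iota> (- r) * y + \<iota> 0 * z = 0" "\<iota> t * x + \<iota> 0 * y + \<iota> (- r) * z = 0"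
      "\<iota> 0 * x + \<iota> t * y + \<iota> (- s) * z = 0"
      using \<iota>_add[of r "- r"] \<iota>_add[of s "- s"]
      by (simp_all add: eq_neg_iff_add_eq_0[symmetric] e[symmetric] algebra_simps)
    then have "r = 0" "s = 0" "t = 0" using independent_crd by (metis neg_equal_0_iff_equal)+
    then have "h * x = 0" "h * y = 0" "h * z = 0" using e by simp_all
    then show "h = 0" by (rule ann_coordinates)
  qed
  then show ?thesis by (auto simp: colon_def)
qed

lemma dim_W1: "H 1 = 3"
proof -
  interpret p: finite_dimensional_vector_space_pair_1 A3.scale A3.Basis_pair sc by unfold_locales
  have "Rel 0 = {0}"
  proof -
    have "t = 0" if "t \<in> Rel 0" for t
      using that independent_crd by (force simp: Rel_def W_0 dot_def zero_prod_def mult.commute)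
    then show ?thesis using A3.p.subspace_0[OF subspace_Rel] by blast
  qed
  then have "A3.p.dim (Rel 0) = 0" by (simp only: A3.p.dim_eq_0)
  then show ?thesis using dim_Rel[of 0] dim_W0 unfolding One_nat_def by linarith
qed

end

text \<open>The Koszul terms drop out because (X, Y, Z) is orthogonal to its vector product with (A,
  B, C).\<close>

lemma koszul_correction:
  fixes X :: "'r::comm_ring_1"
  shows "X * F1 + Y * F2 + Z * F3
    = (X * (F1 - (Y * C - Z * B) - r * Q1) + Y * (F2 - (Z * A - X * C) - r * Q2)
        + Z * (F3 - (X * B - Y * A) - r * Q3)) + r * (X * Q1 + Y * Q2 + Z * Q3)"
proof -
  have "X * (F1 - (Y * C - Z * B) - r * Q1) = X * F1 - (X * Y * C - X * Z * B) - r * (X * Q1)"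
    "Y * (F2 - (Z * A - X * C) - r * Q2) = Y * F2 - (Y * Z * A - X * Y * C) - r * (Y * Q2)"
    "Z * (F3 - (X * B - Y * A) - r * Q3) = Z * F3 - (X * Z * B - Y * Z * A) - r * (Z * Q3)"
    by (simp_all only: right_diff_distrib mult_ac)
  then show ?thesis by (simp add: distrib_left)
qed

section \<open>Independent triples of linear forms and orthogonal complements\<close>

context plane_algebra begin

lemma \<iota>_uminus: "\<iota> (- c) = - \<iota> c"
  using \<iota>_add[of c "- c"] by (simp add: eq_neg_iff_add_eq_0 add.commute)

lemma \<iota>_diff: "\<iota> (c - d) = \<iota> c - \<iota> d"
  using \<iota>_add[of c "- d"] by (simp add: \<iota>_uminus)

lemmas \<iota>_hom = \<iota>_one \<iota>_add \<iota>_mult \<iota>_diff \<iota>_uminus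

definition indep3 :: "'a \<Rightarrow> 'a \<Rightarrow> 'a \<Rightarrow> bool"
  where "indep3 u v w \<longleftrightarrow> (\<forall>r s t. \<iota> r * u + \<iota> s * v + \<iota> t * w = 0 \<longrightarrow> r = 0 \<and> s = 0 \<and> t = 0)"

lemma indep3D: "indep3 u v w \<Longrightarrow> \<iota> r * u + \<iota> s * v + \<iota> t * w = 0 \<Longrightarrow> r = 0 \<and> s = 0 \<and> t = 0"
  by (simp add: indep3_def)

lemma indep3_rotate:
  assumes "indep3 u v w" shows "indep3 v w u"
  unfolding indep3_def
proof (intro allI impI)
  fix r s t assume "\<iota> r * v + \<iota> s * w + \<iota> t * u = 0"
  then have "\<iota> t * u + \<iota> r * v + \<iota> s * w = 0" by (simp add: add_ac)
  then show "r = 0 \<and> s = 0 \<and> t = 0" using assms indep3D by blast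
qed

lemma indep3_crd: "indep3 x y z"
  using independent_crd by (simp add: indep3_def)

lemma in_span2_iff: "u \<in> A.span {v, w} \<longleftrightarrow> (\<exists>r s. u = \<iota> r * v + \<iota> s * w)"
proof -
  have "u \<in> A.span {v, w} \<longleftrightarrow> (\<exists>k. u - \<iota> k * v \<in> range (\<lambda>k. \<iota> k * w))"
    by (simp add: A.span_insert[of v] A.span_singleton)
  then show ?thesis by (simp add: image_iff diff_eq_eq add.commute)
qed

lemma indep3_not_in_span:
  assumes "indep3 u v w" shows "u \<notin> A.span {v, w}"
proof
  assume "u \<in> A.span {v, w}"
  then obtain r s where "u = \<iota> r * v + \<iota> s * w" by (auto simp: in_span2_iff)
  then have "\<iota> 1 * u + \<iota> (- r) * v + \<iota> (- s) * w = 0" by (simp add: \<iota>_hom algebra_simps)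
  with assms show False using indep3D by fastforce
qed

lemma indep3_independent:
  assumes "indep3 u v w" shows "A.independent {u, v, w}" "card {u, v, w} = 3"
proof -
  have u: "u \<notin> A.span {v, w}" and v: "v \<notin> A.span {w, u}" and w: "w \<notin> A.span {u, v}"
    using assms indep3_not_in_span indep3_rotate by blast+
  have "v \<notin> A.span {w}" using v A.span_mono[of "{w}" "{w, u}"] by blast
  moreover have "w \<noteq> 0" using w A.span_zero by metis
  ultimately show "A.independent {u, v, w}"
    using u by (intro A.independent_insertI A.independent_empty) auto
  have "u \<noteq> v" "u \<noteq> w" "v \<noteq> w"
    using u v A.span_base[of v "{v, w}"] A.span_base[of w "{v, w}"] A.span_base[of w "{w, u}"] by auto
  then show "card {u, v, w} = 3" by simp
qed

lemma indep3_spans_W1: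
  assumes "indep3 u v w" "u \<in> W 1" "v \<in> W 1" "w \<in> W 1" "p \<in> W 1"
  obtains r s t where "p = \<iota> r * u + \<iota> s * v + \<iota> t * w"
proof -
  have "W 1 \<subseteq> A.span {u, v, w}"
    using assms(2-4) indep3_independent[OF assms(1)] by (intro A.card_ge_dim_independent) (auto simp: dim_W1 simp del: One_nat_def)
  then have "p \<in> A.span {u, v, w}" using assms(5) by blast
  then obtain r s t where "p - \<iota> r * u = \<iota> s * v + \<iota> t * w"
    by (auto simp: A.span_insert[of u] in_span2_iff)
  then have "p = \<iota> r * u + \<iota> s * v + \<iota> t * w" by (simp add: diff_eq_eq add_ac)
  then show thesis by (rule that)
qed

lemma dual_functional:
  assumes "indep3 u v w"
  obtains \<psi> where "Vector_Spaces.linear sc (*) \<psi>" "\<psi> u = 1" "\<psi> v = 0" "\<psi> w = 0"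
proof (rule A.separating_functional[OF A.subspace_span indep3_not_in_span[OF assms]])
  fix \<psi> assume "Vector_Spaces.linear sc (*) \<psi>" "\<And>a. a \<in> A.span {v, w} \<Longrightarrow> \<psi> a = 0" "\<psi> u = 1"
  then show thesis using that A.span_base[of v "{v, w}"] A.span_base[of w "{v, w}"] by auto
qed

definition perp :: "('a \<Rightarrow> 'k) \<Rightarrow> 'a set"
  where "perp \<phi> = {h. \<phi> (h * x) = 0 \<and> \<phi> (h * y) = 0 \<and> \<phi> (h * z) = 0}"

text \<open>By \<open>onto\<close>, h \<mapsto> (\<phi> (h x), \<phi> (h y), \<phi> (h z)) is a
  surjection onto a three-dimensional space; its kernel is \<open>perp \<phi>\<close>.\<close>

lemma dim_perp:
  assumes lin: "Vector_Spaces.linear sc (*) \<phi>"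
    and onto: "\<And>r s t. \<exists>h. \<phi> (h * x) = r \<and> \<phi> (h * y) = s \<and> \<phi> (h * z) = t"
  shows "A.dim UNIV = 3 + A.dim (perp \<phi>)"
proof -
  interpret \<phi>: Vector_Spaces.linear sc "(*)" \<phi> by fact
  \<comment> \<open>The three values serve as coefficients of the independent x, y, z, which turns
    the surjection into an endomorphism of the algebra with image \<open>W 1\<close>.\<close>
  define T where "T h = \<iota> (\<phi> (h * x)) * x + \<iota> (\<phi> (h * y)) * y + \<iota> (\<phi> (h * z)) * z" for h
  have "T (a + b) = T a + T b" for a b
    unfolding T_def distrib_right \<phi>.add \<iota>_add by (simp only: add_ac)
  moreover have "T (\<iota> c * a) = \<iota> c * T a" for c a
    unfolding T_def mult.assoc \<phi>.scale \<iota>_mult by (simp only: distrib_left)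
  ultimately have "Vector_Spaces.linear sc sc T" by (unfold_locales)
  from A2.rank_nullity[OF this A.subspace_UNIV]
  have rn: "A.dim UNIV = A.dim (range T) + A.dim {h. T h = 0}" by (simp only: UNIV_I simp_thms)
  have range: "range T = W 1"
  proof
    show "range T \<subseteq> W 1" using W1_I by (auto simp: T_def)
    have "\<iota> r * x + \<iota> s * y + \<iota> t * z \<in> range T" for r s t
    proof -
      obtain h where "\<phi> (h * x) = r" "\<phi> (h * y) = s" "\<phi> (h * z) = t" using onto by blast
      then show ?thesis by (metis T_def rangeI)
    qed
    then show "W 1 \<subseteq> range T" by (blast elim: W1_E)
  qed
  have ker: "{h. T h = 0} = perp \<phi>"
    by (auto simp: T_def perp_def dest: independent_crd)
  show ?thesis using rn unfolding range ker dim_W1 .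
qed

text \<open>Since \<open>G\<^sub>1, G\<^sub>2, G\<^sub>3\<close> vanish again, this is an induction step for the claim that all vanishing
  forms lie in a given ideal.\<close>

lemma lift_relation:
  assumes F: "form n F1" "form n F2" "form n F3" and n: "n = Suc m"
    and eq: "(ev F1, ev F2, ev F3) - A3.scale r (ev Q1, ev Q2, ev Q3) \<in> cross ` cube (W m)"
    and Q: "form n Q1" "form n Q2" "form n Q3"
  obtains G1 G2 G3 where "form n G1" "form n G2" "form n G3" "ev G1 = 0" "ev G2 = 0" "ev G3 = 0"
    "var 0 * F1 + var 1 * F2 + var 2 * F3
      = (var 0 * G1 + var 1 * G2 + var 2 * G3)
        + Poly_Mapping.single 0 r * (var 0 * Q1 + var 1 * Q2 + var 2 * Q3)"
proof -
  obtain a b c where abc: "a \<in> W m" "b \<in> W m" "c \<in> W m"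
    and e: "(ev F1, ev F2, ev F3) - A3.scale r (ev Q1, ev Q2, ev Q3) = cross (a, b, c)"
    using eq by auto
  obtain A B C where A: "form m A" "a = ev A" and B: "form m B" "b = ev B" and C: "form m C" "c = ev C"
    using abc by (meson W_E)
  have e': "ev F1 = (y * ev C - z * ev B) + \<iota> r * ev Q1" "ev F2 = (z * ev A - x * ev C) + \<iota> r * ev Q2"
    "ev F3 = (x * ev B - y * ev A) + \<iota> r * ev Q3"
    using e unfolding A(2) B(2) C(2) by (simp_all add: cross_def diff_eq_eq)
  let ?r = "Poly_Mapping.single 0 r :: (3, 'k) mpoly"
  have rQ: "form n (?r * Q)" if "form n Q" for Q using form_mult[OF form_const that] by simp
  show thesis
  proof (rule that[of "F1 - (var 1 * C - var 2 * B) - ?r * Q1" "F2 - (var 2 * A - var 0 * C) - ?r * Q2"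
        "F3 - (var 0 * B - var 1 * A) - ?r * Q3"])
    show "form n (F1 - (var 1 * C - var 2 * B) - ?r * Q1)" "form n (F2 - (var 2 * A - var 0 * C) - ?r * Q2)"
      "form n (F3 - (var 0 * B - var 1 * A) - ?r * Q3)"
      using A(1) B(1) C(1) F rQ[OF Q(1)] rQ[OF Q(2)] rQ[OF Q(3)] unfolding n by (auto intro!: form_diff form_var_mult)
    show "ev (F1 - (var 1 * C - var 2 * B) - ?r * Q1) = 0" "ev (F2 - (var 2 * A - var 0 * C) - ?r * Q2) = 0"
      "ev (F3 - (var 0 * B - var 1 * A) - ?r * Q3) = 0"
      using e' by (simp_all add: ev_simps algebra_simps diff_eq_eq del: poly_value_single)
    show "var 0 * F1 + var 1 * F2 + var 2 * F3
      = (var 0 * (F1 - (var 1 * C - var 2 * B) - ?r * Q1) + var 1 * (F2 - (var 2 * A - var 0 * C) - ?r * Q2)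
          + var 2 * (F3 - (var 0 * B - var 1 * A) - ?r * Q3))
        + ?r * (var 0 * Q1 + var 1 * Q2 + var 2 * Q3)"
      by (rule koszul_correction)
  qed
qed

end

interpretation ideal: module "(*) :: 'r::comm_ring_1 \<Rightarrow> 'r \<Rightarrow> 'r"
  by unfold_locales (simp_all add: algebra_simps)

declare ideal.scale_scale [simp del]

context plane_algebra begin

definition vanishing_forms :: "(3, 'k) mpoly set"
  where "vanishing_forms = {F. \<exists>d. form d F \<and> ev F = 0}"

lemma form_1_ev_0:
  assumes "form 1 F" "ev F = 0" shows "F = 0"
proof -
  have "form (Suc 0) F" using assms(1) by simp
  then obtain A B C where F: "form 0 A" "form 0 B" "form 0 C" "F = var 0 * A + var 1 * B + var 2 * C"
    by (rule form_decompose)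
  obtain r s t where "A = Poly_Mapping.single 0 r" "B = Poly_Mapping.single 0 s" "C = Poly_Mapping.single 0 t"
    using F(1-3) by (metis form_0D)
  moreover from this have "\<iota> r * x + \<iota> s * y + \<iota> t * z = 0"
    using assms(2) by (simp add: F(4) ev_simps mult.commute)
  ultimately show ?thesis using independent_crd F(4) by fastforce
qed

lemma form_0_ev_0:
  assumes "form 0 F" "ev F = 0" shows "F = 0"
proof -
  obtain r where r: "F = Poly_Mapping.single 0 r" using assms(1) by (rule form_0D)
  then have "\<iota> r = 0" using assms(2) by simp
  then have "\<iota> r * x + \<iota> 0 * y + \<iota> 0 * z = 0" by simp
  then show ?thesis using independent_crd r by fastforce
qed

end

section \<open>From self-duality to a conic and a cubic\<close>

text \<open>Every functional is a multiple of \<phi> by \<open>representing\<close>, and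
  \<open>perp_\<phi>\<close> makes the space of linear forms its own orthogonal under (f, g)
  \<mapsto> \<phi> (f g).\<close>

locale self_dual_plane_algebra = plane_algebra \<iota> crd
  for \<iota> :: "'k::field \<Rightarrow> 'a::comm_ring_1" and crd :: "3 \<Rightarrow> 'a" +
  fixes \<phi> :: "'a \<Rightarrow> 'k"
  assumes linear_\<phi>: "Vector_Spaces.linear (\<lambda>c a. \<iota> c * a) (*) \<phi>"
    and representing: "Vector_Spaces.linear (\<lambda>c a. \<iota> c * a) (*) \<psi> \<Longrightarrow> \<exists>h. \<psi> = (\<lambda>u. \<phi> (h * u))"
    and perp_\<phi>: "perp \<phi> = W 1"
begin

sublocale \<phi>: Vector_Spaces.linear sc "(*)" \<phi>
  by (rule linear_\<phi>)

lemma \<phi>_crd: "f \<in> W 1 \<Longrightarrow> \<phi> (crd i * f) = 0"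
proof -
  assume "f \<in> W 1"
  then have f: "\<phi> (x * f) = 0" "\<phi> (y * f) = 0" "\<phi> (z * f) = 0"
    unfolding perp_\<phi>[symmetric] perp_def by (simp_all add: mult.commute)
  consider "i = 0" | "i = 1" | "i = 2" using exhaust_3[of i] by auto
  then show ?thesis using f by cases auto
qed

lemma \<phi>_W2: "f \<in> W 2 \<Longrightarrow> \<phi> f = 0"
proof -
  assume "f \<in> W 2"
  then have "f \<in> W (Suc 1)" by (simp add: numeral_2_eq_2)
  then obtain g h k where "g \<in> W 1" "h \<in> W 1" "k \<in> W 1" "f = x * g + y * h + z * k"
    by (rule W_Suc_E)
  then show ?thesis by (simp add: \<phi>.add \<phi>_crd)
qed

text \<open>The functionals dual to x, y, z are multiples of \<phi>; the combination of the three
  multipliers with coefficients r, s, t is the required h.\<close>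

lemma onto: "\<exists>h. \<phi> (h * x) = r \<and> \<phi> (h * y) = s \<and> \<phi> (h * z) = t"
proof -
  note ind = indep3_crd indep3_rotate[OF indep3_crd] indep3_rotate[OF indep3_rotate[OF indep3_crd]]
  obtain \<psi> where \<psi>: "Vector_Spaces.linear sc (*) \<psi>" "\<psi> x = 1" "\<psi> y = 0" "\<psi> z = 0"
    by (rule dual_functional[OF ind(1)])
  obtain h where h: "\<psi> = (\<lambda>u. \<phi> (h * u))" using representing[OF \<psi>(1)] by blast
  obtain \<psi>' where \<psi>': "Vector_Spaces.linear sc (*) \<psi>'" "\<psi>' y = 1" "\<psi>' z = 0" "\<psi>' x = 0"
    by (rule dual_functional[OF ind(2)])
  obtain h' where h': "\<psi>' = (\<lambda>u. \<phi> (h' * u))" using representing[OF \<psi>'(1)] by blast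
  obtain \<psi>'' where \<psi>'': "Vector_Spaces.linear sc (*) \<psi>''" "\<psi>'' z = 1" "\<psi>'' x = 0" "\<psi>'' y = 0"
    by (rule dual_functional[OF ind(3)])
  obtain h'' where h'': "\<psi>'' = (\<lambda>u. \<phi> (h'' * u))" using representing[OF \<psi>''(1)] by blast
  show ?thesis
    using \<psi>(2-4) \<psi>'(2-4) \<psi>''(2-4)
    by (intro exI[of _ "\<iota> r * h + \<iota> s * h' + \<iota> t * h''"])
      (simp add: h h' h'' distrib_right mult.assoc \<phi>.add \<phi>.scale)
qed

lemma dim_A: "A.dim UNIV = 6"
  using dim_perp[OF linear_\<phi> onto] unfolding perp_\<phi> dim_W1 by simp

lemma nondegenerate:
  assumes "\<And>u. \<phi> (h * u) = 0" shows "h = 0"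
proof (rule ccontr)
  assume "h \<noteq> 0"
  then obtain \<psi> where \<psi>: "Vector_Spaces.linear sc (*) \<psi>" "\<psi> h = 1"
    using A.separating_functional[OF A.subspace_single_0, of h] by auto
  then obtain g where "\<psi> = (\<lambda>u. \<phi> (g * u))" using representing by blast
  with \<psi>(2) assms[of g] show False by (simp add: mult.commute)
qed

text \<open>The multiplications by elements of the algebra that preserve the space of linear forms are
  scalars. A non-scalar one has, as an endomorphism of a three-dimensional space, a cyclic vector or
  rank one up to a scalar. With a cyclic vector \<open>u\<close> all sections of degree \<open>d + 1\<close> are of the form
  \<open>u\<^sup>d v\<close> with \<open>v\<close> linear, so that they span a space of dimension at most three.\<close>

lemma no_cyclic_vector:
  assumes b: "\<And>v. v \<in> W 1 \<Longrightarrow> b * v \<in> W 1" and u: "u \<in> W 1"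
    and ind: "indep3 u (b * u) (b * (b * u))"
  shows False
proof -
  have bu: "b * u \<in> W 1" "b * (b * u) \<in> W 1" using b u by blast+
  \<comment> \<open>\<open>v\<close> is a polynomial in \<open>b\<close> applied to
    \<open>u\<close>. Moving that polynomial over to \<open>w\<close>, which stays a linear form,
    gives the factor \<open>p\<close>.\<close>
  have mult: "\<exists>p\<in>W 1. v * w = u * p" if v: "v \<in> W 1" and w: "w \<in> W 1" for v w
  proof -
    obtain r s t where v: "v = \<iota> r * u + \<iota> s * (b * u) + \<iota> t * (b * (b * u))"
      using indep3_spans_W1[OF ind u bu v] .
    have "\<iota> r * w + \<iota> s * (b * w) + \<iota> t * (b * (b * w)) \<in> W 1"
      by (intro W_add W_scale w b)
    moreover have "v * w = u * (\<iota> r * w + \<iota> s * (b * w) + \<iota> t * (b * (b * w)))"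
      unfolding v by (simp add: algebra_simps)
    ultimately show ?thesis by blast
  qed
  have W_le: "W (Suc d) \<subseteq> (*) (u ^ d) ` W 1" for d
  proof (induction d)
    case 0
    then show ?case by force
  next
    case (Suc d)
    show ?case
    proof
      fix f assume "f \<in> W (Suc (Suc d))"
      then obtain g h k where f: "g \<in> W (Suc d)" "h \<in> W (Suc d)" "k \<in> W (Suc d)" "f = x * g + y * h + z * k"
        by (rule W_Suc_E)
      have "g \<in> (*) (u ^ d) ` W 1" "h \<in> (*) (u ^ d) ` W 1" "k \<in> (*) (u ^ d) ` W 1"
        using Suc f(1-3) by blast+
      then obtain g' h' k' where g': "g' \<in> W 1" "h' \<in> W 1" "k' \<in> W 1"
        "g = u ^ d * g'" "h = u ^ d * h'" "k = u ^ d * k'" by blast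
      obtain p1 p2 p3 where p: "p1 \<in> W 1" "x * g' = u * p1" "p2 \<in> W 1" "y * h' = u * p2" "p3 \<in> W 1" "z * k' = u * p3"
        using mult[OF crd_in_W1 g'(1), of 0] mult[OF crd_in_W1 g'(2), of 1] mult[OF crd_in_W1 g'(3), of 2] by blast
      have "f = u ^ d * (x * g' + y * h' + z * k')" by (simp add: f(4) g'(4-6) algebra_simps)
      also have "\<dots> = u ^ Suc d * (p1 + p2 + p3)" unfolding p by (simp add: algebra_simps)
      finally show "f \<in> (*) (u ^ Suc d) ` W 1" using p by (intro image_eqI[of _ _ "p1 + p2 + p3"] W_add) auto
    qed
  qed
  obtain D where "W D = UNIV" using ex_W_UNIV by blast
  then have "UNIV \<subseteq> (*) (u ^ D) ` W 1" using W_le[of D] W_Suc_UNIV by auto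
  then have "A.dim UNIV \<le> A.dim ((*) (u ^ D) ` W 1)" by (rule A.dim_subset)
  also have "\<dots> \<le> 3" using dim_multiples_le[of "u ^ D" "W 1"] unfolding dim_W1 .
  finally show False unfolding dim_A by simp
qed

text \<open>A multiplication of rank one: with \<open>p\<close> in its image, \<open>p A\<close> is one-dimensional, hence spanned by
  a product of two linear forms and killed by \<open>\<phi>\<close>.\<close>

lemma no_rank_one:
  assumes p: "p \<in> W 1" "p \<noteq> 0" and v: "v \<in> W 1"
    and pv: "\<And>m. m \<in> W 1 \<Longrightarrow> \<exists>r. p * m = \<iota> r * (p * v)"
  shows False
proof -
  have pW: "\<exists>r. p * f = \<iota> r * (p * v ^ d)" if "f \<in> W d" for f d
    using that
  proof (induction d arbitrary: f)
    case 0
    then show ?case by (auto simp: W_0 mult.commute)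
  next
    case (Suc d)
    have step: "\<exists>r. p * (crd i * g) = \<iota> r * (p * v ^ Suc d)" if g: "g \<in> W d" for i g
    proof -
      obtain r where r: "p * crd i = \<iota> r * (p * v)" using pv crd_in_W1 by blast
      obtain s where s: "p * g = \<iota> s * (p * v ^ d)" using Suc.IH[OF g] by blast
      have "p * (crd i * g) = (p * crd i) * g" by (simp add: mult.assoc)
      also have "\<dots> = \<iota> r * v * (p * g)" by (simp add: r algebra_simps)
      also have "\<dots> = \<iota> (r * s) * (p * v ^ Suc d)" unfolding s by (simp add: \<iota>_mult algebra_simps)
      finally show ?thesis by blast
    qed
    obtain g h k where f: "g \<in> W d" "h \<in> W d" "k \<in> W d" "f = x * g + y * h + z * k"
      using Suc.prems by (rule W_Suc_E)
    obtain r s t where e: "p * (x * g) = \<iota> r * (p * v ^ Suc d)" "p * (y * h) = \<iota> s * (p * v ^ Suc d)"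
      "p * (z * k) = \<iota> t * (p * v ^ Suc d)" using step[OF f(1), of 0] step[OF f(2), of 1] step[OF f(3), of 2] by blast
    have "p * f = \<iota> (r + s + t) * (p * v ^ Suc d)"
      unfolding f(4) distrib_left e \<iota>_add distrib_right ..
    then show ?case by blast
  qed
  obtain D where D: "W D = UNIV" using ex_W_UNIV by blast
  define e where "e = p * v ^ D"
  have pe: "\<exists>r. p * a = \<iota> r * e" for a using pW[of a D] D by (simp add: e_def)
  \<comment> \<open>Being nonzero, \<open>p * v\<close> spans the line of all multiples of
    \<open>p\<close>; it lies in \<open>W 2\<close>, where \<phi> vanishes.\<close>
  have "p * v \<noteq> 0"
  proof
    assume "p * v = 0"
    then have "p * crd i = 0" for i using pv[OF crd_in_W1, of i] by auto
    then show False using p(2) ann_coordinates by blast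
  qed
  moreover obtain r where r: "p * v = \<iota> r * e" using pe by blast
  ultimately have "r \<noteq> 0" by auto
  have "\<phi> (p * a) = 0" for a
  proof -
    obtain s where "p * a = \<iota> s * e" using pe by blast
    also have "\<dots> = \<iota> (s / r) * (p * v)"
      using \<open>r \<noteq> 0\<close> by (simp add: r \<iota>_mult[symmetric] mult.assoc[symmetric])
    finally have "p * a = \<iota> (s / r) * (p * v)" .
    moreover have "p * v \<in> W 2" using W_mult[OF p(1) v] by (simp add: numeral_2_eq_2)
    ultimately show ?thesis by (metis W_scale \<phi>_W2)
  qed
  then show False using nondegenerate p(2) by blast
qed

text \<open>If \<mu> is nonzero, then \<open>w\<close> is a cyclic vector; if \<mu> = 0 and \<beta>
  is nonzero, then \<open>w + v\<close> is one. In the remaining case \<open>b * v\<close>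
  multiplies each of the basis vectors \<open>v\<close>, \<open>b * v\<close>, \<open>w\<close> to a
  multiple of \<open>(b * v) * v\<close>, which \<open>no_rank_one\<close> excludes.\<close>

lemma no_companion_block:
  assumes b: "\<And>v. v \<in> W 1 \<Longrightarrow> b * v \<in> W 1" and v: "v \<in> W 1" and w: "w \<in> W 1"
    and ind: "indep3 v (b * v) w"
    and bbv: "b * (b * v) = \<iota> \<alpha> * (b * v) + \<iota> \<beta> * v" and bw: "b * w = \<iota> \<mu> * v"
  shows False
proof -
  have \<mu>: "\<mu> = 0"
  proof (rule ccontr)
    assume "\<mu> \<noteq> 0"
    have "indep3 w (b * w) (b * (b * w))"
      unfolding indep3_def
    proof (intro allI impI)
      fix r s t assume "\<iota> r * w + \<iota> s * (b * w) + \<iota> t * (b * (b * w)) = 0"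
      then have "\<iota> (s * \<mu>) * v + \<iota> (t * \<mu>) * (b * v) + \<iota> r * w = 0"
        unfolding bw by (simp add: \<iota>_mult algebra_simps)
      then show "r = 0 \<and> s = 0 \<and> t = 0" using indep3D[OF ind] \<open>\<mu> \<noteq> 0\<close> by fastforce
    qed
    then show False using no_cyclic_vector[OF b w] by blast
  qed
  have \<beta>: "\<beta> = 0"
  proof (rule ccontr)
    assume "\<beta> \<noteq> 0"
    have "indep3 (w + v) (b * (w + v)) (b * (b * (w + v)))"
      unfolding indep3_def
    proof (intro allI impI)
      fix r s t assume *: "\<iota> r * (w + v) + \<iota> s * (b * (w + v)) + \<iota> t * (b * (b * (w + v))) = 0"
      have "b * (w + v) = b * v" using bw \<mu> by (simp add: distrib_left)
      with * have "\<iota> (r + t * \<beta>) * v + \<iota> (s + t * \<alpha>) * (b * v) + \<iota> r * w = 0"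
        unfolding \<open>b * (w + v) = b * v\<close> bbv by (simp add: \<iota>_hom algebra_simps)
      then show "r = 0 \<and> s = 0 \<and> t = 0" using indep3D[OF ind] \<open>\<beta> \<noteq> 0\<close> by fastforce
    qed
    then show False using no_cyclic_vector[OF b W_add[OF w v]] by blast
  qed
  have "b * v \<noteq> 0"
  proof
    assume "b * v = 0"
    then have "\<iota> 0 * v + \<iota> 1 * (b * v) + \<iota> 0 * w = 0" by simp
    then show False using indep3D[OF ind] by fastforce
  qed
  moreover have "\<exists>r. (b * v) * m = \<iota> r * ((b * v) * v)" if m: "m \<in> W 1" for m
  proof -
    obtain r s t where m: "m = \<iota> r * v + \<iota> s * (b * v) + \<iota> t * w"
      using indep3_spans_W1[OF ind v b[OF v] w m] .
    have "(b * v) * m = \<iota> r * ((b * v) * v) + \<iota> s * (v * (b * (b * v))) + \<iota> t * (v * (b * w))"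
      unfolding m by (simp add: algebra_simps)
    also have "\<dots> = \<iota> (r + s * \<alpha>) * ((b * v) * v)"
      unfolding bw bbv \<mu> \<beta> by (simp add: \<iota>_hom algebra_simps)
    finally show ?thesis by blast
  qed
  ultimately show False using no_rank_one[OF b[OF v] _ v] by blast
qed

text \<open>A non-scalar \<open>b\<close> that preserves the linear forms has a vector
  \<open>v\<close> that is not an eigenvector. As \<open>v\<close> is not cyclic either,
  \<open>v\<close> and \<open>b * v\<close> span an invariant plane, and a third basis vector can be
  normalized so that \<open>no_companion_block\<close> applies.\<close>

lemma colon_1: "colon 1 = range \<iota>"
proof
  show "range \<iota> \<subseteq> colon 1" using \<iota>_in_colon by blast
  show "colon 1 \<subseteq> range \<iota>"
  proof (rule ccontr)
    assume "\<not> colon 1 \<subseteq> range \<iota>"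
    then obtain b where "b \<in> colon 1" and b_scalar: "b \<notin> range \<iota>" by blast
    then have b: "b * v \<in> W 1" if "v \<in> W 1" for v
    proof -
      obtain r s t where "v = \<iota> r * x + \<iota> s * y + \<iota> t * z" using \<open>v \<in> W 1\<close> by (rule W1_E)
      then have "b * v = \<iota> r * (b * x) + \<iota> s * (b * y) + \<iota> t * (b * z)" by (simp add: algebra_simps)
      also have "\<dots> \<in> W 1" using \<open>b \<in> colon 1\<close> by (intro W_add W_scale) (auto simp: colon_def)
      finally show ?thesis .
    qed
    have "\<exists>v\<in>W 1. \<forall>r. b * v \<noteq> \<iota> r * v"
    proof (rule ccontr)
      assume "\<not> ?thesis"
      then have ev: "\<exists>r. b * v = \<iota> r * v" if "v \<in> W 1" for v using that by blast
      obtain r s t where r: "b * x = \<iota> r * x" and s: "b * y = \<iota> s * y" and t: "b * z = \<iota> t * z"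
        using ev crd_in_W1 by metis
      \<comment> \<open>The eigenvalues at x, y and z all agree with the one at the sum x + y +
        z.\<close>
      obtain p where p: "b * (x + y + z) = \<iota> p * (x + y + z)" using ev W_add crd_in_W1 by metis
      have "\<iota> (r - p) * x + \<iota> (s - p) * y + \<iota> (t - p) * z = b * (x + y + z) - \<iota> p * (x + y + z)"
        by (simp add: distrib_left r s t \<iota>_diff left_diff_distrib)
      then have "\<iota> (r - p) * x + \<iota> (s - p) * y + \<iota> (t - p) * z = 0" by (simp add: p)
      then have "r = p" "s = p" "t = p" using independent_crd by fastforce+
      then have "(b - \<iota> p) * x = 0" "(b - \<iota> p) * y = 0" "(b - \<iota> p) * z = 0"
        using r s t by (simp_all add: left_diff_distrib)
      then have "b - \<iota> p = 0" by (rule ann_coordinates)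
      then show False using b_scalar by auto
    qed
    then obtain v where v: "v \<in> W 1" and bv: "\<And>r. b * v \<noteq> \<iota> r * v" by blast
    define X where "X = b * v"
    have X: "X \<in> W 1" unfolding X_def using b v .
    have "v \<noteq> 0" using bv by fastforce
    have indep2: "r = 0 \<and> s = 0" if rs: "\<iota> r * v + \<iota> s * X = 0" for r s
    proof -
      have s: "s = 0"
      proof (rule ccontr)
        assume "s \<noteq> 0"
        then have "X = \<iota> (inverse s * s) * X" by (simp add: \<iota>_one)
        also have "\<dots> = \<iota> (inverse s) * (\<iota> s * X)" by (simp add: \<iota>_mult mult.assoc)
        also have "\<dots> = \<iota> (- inverse s * r) * v"
          using rs by (simp add: add_eq_0_iff2 \<iota>_hom mult.assoc)
        finally have "b * v = \<iota> (- inverse s * r) * v" unfolding X_def .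
        then show False using bv by blast
      qed
      with rs have "\<iota> r * v = 0" by simp
      then have "r = 0" using A.scale_eq_0_iff[of r v] \<open>v \<noteq> 0\<close> by blast
      with s show ?thesis by simp
    qed
    have indep3_ext: "indep3 v X w" if "\<And>r s. w \<noteq> \<iota> r * v + \<iota> s * X" for w
      unfolding indep3_def
    proof (intro allI impI)
      fix r s t assume e: "\<iota> r * v + \<iota> s * X + \<iota> t * w = 0"
      have t: "t = 0"
      proof (rule ccontr)
        assume "t \<noteq> 0"
        then have "w = \<iota> (inverse t * t) * w" by (simp add: \<iota>_one)
        also have "\<dots> = \<iota> (inverse t) * (\<iota> t * w)" by (simp add: \<iota>_mult mult.assoc)
        also have "\<iota> t * w = - (\<iota> r * v + \<iota> s * X)" using e by (simp add: add_eq_0_iff)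
        also have "\<iota> (inverse t) * - (\<iota> r * v + \<iota> s * X) = \<iota> (- inverse t * r) * v + \<iota> (- inverse t * s) * X"
          by (simp add: \<iota>_hom algebra_simps)
        finally show False using that by blast
      qed
      with e have "\<iota> r * v + \<iota> s * X = 0" by simp
      with t indep2 show "r = 0 \<and> s = 0 \<and> t = 0" by blast
    qed
    obtain \<beta> \<alpha> where bX: "b * X = \<iota> \<beta> * v + \<iota> \<alpha> * X"
    proof (rule ccontr)
      assume "\<not> thesis"
      then have "indep3 v X (b * X)" using that by (intro indep3_ext) blast
      then show False using no_cyclic_vector[OF b v] by (simp add: X_def)
    qed
    obtain w where w: "w \<in> W 1" and ind: "indep3 v X w"
    proof (rule ccontr)
      assume "\<not> thesis"
      then have "\<exists>r s. u = \<iota> r * v + \<iota> s * X" if "u \<in> W 1" for u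
        using indep3_ext[of u] that \<open>\<And>w. w \<in> W 1 \<Longrightarrow> indep3 v X w \<Longrightarrow> thesis\<close> by blast
      then have "W 1 \<subseteq> A.span {v, X}" by (auto simp: in_span2_iff)
      then have "A.dim (W 1) \<le> card {v, X}" by (rule A.dim_le_card) simp
      also have "\<dots> \<le> 2" by (simp add: card_insert_if)
      finally show False unfolding dim_W1 by simp
    qed
    obtain m l n where bw: "b * w = \<iota> m * v + \<iota> l * X + \<iota> n * w"
      using indep3_spans_W1[OF ind v X w b[OF w]] .
    \<comment> \<open>\<open>n\<close> is the eigenvalue of \<open>b\<close> on the quotient by the
      invariant plane. Subtracting it from \<open>b\<close> and shearing \<open>w\<close> by a
      multiple of \<open>v\<close> leaves \<open>b' * w'\<close> a multiple of
      \<open>v\<close>.\<close>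
    define b' w' where "b' = b - \<iota> n" and "w' = w - \<iota> l * v"
    have X': "b' * v = X - \<iota> n * v" by (simp add: b'_def X_def left_diff_distrib)
    show False
    proof (rule no_companion_block[of b' v w'])
      show "b' * u \<in> W 1" if "u \<in> W 1" for u
        using that b W_scale unfolding b'_def left_diff_distrib by (intro W_diff) auto
      show "v \<in> W 1" by (rule v)
      show "w' \<in> W 1" unfolding w'_def by (intro W_diff W_scale w v)
      show "b' * w' = \<iota> (m + l * n) * v"
        unfolding b'_def w'_def using bw by (simp add: X_def \<iota>_hom algebra_simps)
      show "b' * (b' * v) = \<iota> (\<alpha> - n - n) * (b' * v) + \<iota> ((\<alpha> - n) * n + \<beta>) * v"
        unfolding X' unfolding b'_def using bX X_def \<iota>_add[of 1 1] by (simp add: \<iota>_hom algebra_simps)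
      show "indep3 v (b' * v) w'"
        unfolding indep3_def
      proof (intro allI impI)
        fix r s t assume "\<iota> r * v + \<iota> s * (b' * v) + \<iota> t * w' = 0"
        then have "\<iota> (r - s * n - t * l) * v + \<iota> s * X + \<iota> t * w = 0"
          unfolding X' w'_def by (simp add: \<iota>_hom algebra_simps)
        then show "r = 0 \<and> s = 0 \<and> t = 0" using indep3D[OF ind] by fastforce
      qed
    qed
  qed
qed

end

section \<open>Relations and generators of the homogeneous ideal\<close>

context plane_algebra begin

lemma var_combination_in_span:
  fixes G1 G2 G3 :: "(3, 'k) mpoly"
  assumes "G1 \<in> ideal.span S" "G2 \<in> ideal.span S" "G3 \<in> ideal.span S"
  shows "var 0 * G1 + var 1 * G2 + var 2 * G3 \<in> ideal.span S"
  using assms by (intro ideal.span_add ideal.span_scale)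

lemma Rel_E:
  assumes "u \<in> Rel d"
  obtains F1 F2 F3 where "form d F1" "form d F2" "form d F3" "u = (ev F1, ev F2, ev F3)"
    "form (Suc d) (var 0 * F1 + var 1 * F2 + var 2 * F3)" "ev (var 0 * F1 + var 1 * F2 + var 2 * F3) = 0"
proof -
  obtain a b c where u: "u = (a, b, c)" "a \<in> W d" "b \<in> W d" "c \<in> W d" "x * a + y * b + z * c = 0"
    using assms by (auto simp: Rel_def dot_def)
  obtain F1 F2 F3 where F: "form d F1" "a = ev F1" "form d F2" "b = ev F2" "form d F3" "c = ev F3"
    using u(2-4) by (meson W_E)
  show thesis
    by (rule that[of F1 F2 F3]) (use u F in \<open>auto simp: ev_simps intro!: form_add form_var_mult\<close>)
qed

lemma Rel_I:
  assumes "form d F1" "form d F2" "form d F3" "ev (var 0 * F1 + var 1 * F2 + var 2 * F3) = 0"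
  shows "(ev F1, ev F2, ev F3) \<in> Rel d"
  using assms by (auto simp: Rel_def dot_def ev_simps W_I)

text \<open>If the form were zero as a polynomial, its coefficients would be a Koszul triple by
  \<open>koszul_poly\<close>, and so would their values at the coordinates.\<close>

lemma nonzero_of_not_cross:
  assumes "form (Suc d) F1" "form (Suc d) F2" "form (Suc d) F3"
    and "(ev F1, ev F2, ev F3) \<notin> cross ` cube (W d)"
  shows "var 0 * F1 + var 1 * F2 + var 2 * F3 \<noteq> 0"
proof
  assume "var 0 * F1 + var 1 * F2 + var 2 * F3 = 0"
  then obtain A B C where "form (Suc d - 1) A" "form (Suc d - 1) B" "form (Suc d - 1) C"
    "F1 = var 1 * C - var 2 * B" "F2 = var 2 * A - var 0 * C" "F3 = var 0 * B - var 1 * A"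
    using koszul_poly assms(1-3) by metis
  then have "(ev F1, ev F2, ev F3) = cross (ev A, ev B, ev C)" "(ev A, ev B, ev C) \<in> cube (W d)"
    by (simp_all add: cross_def ev_simps W_I)
  then show False using assms(4) by (metis image_eqI)
qed

end

context self_dual_plane_algebra begin

text \<open>A functional that vanishes on \<open>W 2\<close> has the form u \<mapsto> \<phi> (h u).
  Then h times a linear form is orthogonal to all linear forms, hence linear itself. By
  \<open>colon_1\<close>, h is a scalar and the functional is a multiple of \<phi>.\<close>

lemma W2_eq: "W 2 = {f. \<phi> f = 0}"
proof
  show "W 2 \<subseteq> {f. \<phi> f = 0}" using \<phi>_W2 by blast
  show "{f. \<phi> f = 0} \<subseteq> W 2"
  proof (rule ccontr)
    assume "\<not> ?thesis"
    then obtain f where f: "\<phi> f = 0" "f \<notin> W 2" by blast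
    obtain \<psi> where \<psi>: "Vector_Spaces.linear sc (*) \<psi>" "\<And>u. u \<in> W 2 \<Longrightarrow> \<psi> u = 0" "\<psi> f = 1"
      using A.separating_functional[OF subspace_W f(2)] by blast
    obtain h where h: "\<psi> = (\<lambda>u. \<phi> (h * u))" using representing[OF \<psi>(1)] by blast
    have "h * crd i \<in> W 1" for i
    proof -
      have "\<phi> (h * crd i * crd j) = 0" for j
      proof -
        have "crd i * crd j \<in> W 2" using W_mult[OF crd_in_W1 crd_in_W1, of i j] by (simp add: numeral_2_eq_2)
        then show ?thesis using \<psi>(2) unfolding h by (simp add: mult.assoc)
      qed
      then show ?thesis unfolding perp_\<phi>[symmetric] perp_def by blast
    qed
    then have "h \<in> colon 1" by (simp add: colon_def)
    then obtain r where "h = \<iota> r" unfolding colon_1 by blast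
    then have "\<psi> f = r * \<phi> f" unfolding h by (simp only: \<phi>.scale)
    with f \<psi>(3) show False by simp
  qed
qed

text \<open>The same duality one degree up: if u \<mapsto> \<phi> (h u) kills \<open>W 3\<close>,
  then h x, h y and h z preserve the linear forms, so they are scalars and h = 0 by
  \<open>colon_0\<close>.\<close>

lemma W3_eq: "W 3 = UNIV"
proof (rule ccontr)
  assume "W 3 \<noteq> UNIV"
  then obtain f where f: "f \<notin> W 3" by blast
  obtain \<psi> where \<psi>: "Vector_Spaces.linear sc (*) \<psi>" "\<And>u. u \<in> W 3 \<Longrightarrow> \<psi> u = 0" "\<psi> f = 1"
    using A.separating_functional[OF subspace_W f] by blast
  obtain h where h: "\<psi> = (\<lambda>u. \<phi> (h * u))" using representing[OF \<psi>(1)] by blast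
  have "h * crd i \<in> colon 1" for i
  proof -
    have "h * crd i * crd j \<in> W 1" for j
    proof -
      have "\<phi> (h * crd i * crd j * crd k) = 0" for k
      proof -
        have "crd i * crd j * crd k \<in> W (1 + 1 + 1)" by (intro W_mult crd_in_W1)
        then have "crd i * crd j * crd k \<in> W 3" by (simp add: numeral_3_eq_3)
        then show ?thesis using \<psi>(2) unfolding h by (simp add: mult.assoc)
      qed
      then show ?thesis unfolding perp_\<phi>[symmetric] perp_def by blast
    qed
    then show ?thesis by (simp add: colon_def)
  qed
  then have "h \<in> colon 0" unfolding colon_1 by (simp add: colon_def W_0)
  then have "h = 0" by (simp add: colon_0)
  then show False using \<psi>(3) by (simp add: h)
qed

lemma H2: "H 2 = 5"
proof -
  have "\<exists>u. \<phi> u \<noteq> 0"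
  proof (rule ccontr)
    assume "\<not> ?thesis"
    then have "W 2 = UNIV" unfolding W2_eq by blast
    then have "\<phi> (1 * u) = 0" for u using \<phi>_W2 by simp
    then have "(1::'a) = 0" by (rule nondegenerate)
    then show False by simp
  qed
  then obtain u where u: "\<phi> u \<noteq> 0" by blast
  then have "W 2 \<noteq> UNIV" unfolding W2_eq by blast
  then have "H 2 \<noteq> 6"
    using A.subspace_dim_equal[OF subspace_W A.subspace_UNIV subset_UNIV, of 2] dim_A by auto
  moreover have "H 2 \<le> 6" using A.dim_subset[of "W 2" UNIV] dim_A by auto
  moreover have "A.dim UNIV \<le> Suc (H 2)"
  proof (rule A.dim_le_Suc)
    fix v
    have "\<phi> (v - \<iota> (\<phi> v / \<phi> u) * u) = 0" using u by (simp add: \<phi>.diff \<phi>.scale)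
    then show "\<exists>r. v - \<iota> r * u \<in> W 2" unfolding W2_eq by blast
  qed
  ultimately show ?thesis using dim_A by simp
qed

text \<open>A preimage under \<open>cross\<close> exists over the whole algebra, which is
  \<open>W (d - 1)\<close> for \<open>d > 3\<close>. For \<open>d = 3\<close> a multiple h (x, y,
  z), which \<open>cross\<close> kills, is subtracted from it; \<open>onto\<close> provides an h for
  which the entries land in the kernel of \<phi>, that is, in \<open>W 2\<close>.\<close>

lemma Rel_ge_3:
  assumes "d \<ge> 3" shows "Rel d \<subseteq> cross ` cube (W (d - 1))"
proof
  fix t assume t: "t \<in> Rel d"
  then obtain g1 g2 g3 where g: "t = cross (g1, g2, g3)" using koszul_dot[of t] by (auto simp: Rel_def)
  show "t \<in> cross ` cube (W (d - 1))"
  proof (cases "d = 3")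
    case False
    then have "W (d - 1) = UNIV" using W_UNIV_mono[OF _ W3_eq, of "d - 1"] assms by simp
    then show ?thesis using g by simp
  next
    case True
    obtain h where h: "\<phi> (h * x) = \<phi> g1" "\<phi> (h * y) = \<phi> g2" "\<phi> (h * z) = \<phi> g3" using onto by blast
    have "t = cross (g1 - h * x, g2 - h * y, g3 - h * z)"
      unfolding g cross_def by (simp add: algebra_simps)
    moreover have "(g1 - h * x, g2 - h * y, g3 - h * z) \<in> cube (W 2)"
      unfolding W2_eq by (simp add: \<phi>.diff h)
    ultimately show ?thesis using True by simp
  qed
qed

text \<open>Modulo the Koszul relations, \<open>Rel d\<close> has dimension one for
  \<open>d = 1\<close> and for \<open>d = 2\<close>, and zero from 3 on. Lifting a spanning relation
  to forms yields \<open>q\<close> and \<open>c\<close>.\<close>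

lemma conic_cubic_generators:
  obtains q c where "form 2 q" "q \<noteq> 0" "form 3 c" "c \<noteq> 0"
    "ideal.span vanishing_forms = ideal.span {q, c}"
proof -
  have "H (Suc 1) = 5" "H (Suc 2) = 6" using H2 W3_eq dim_A by (simp_all add: numeral_2_eq_2 numeral_3_eq_3)
  \<comment> \<open>The counts are 9 - 5 = 4 against 3 - 0 = 3, and 15 - 6 = 9 against 9 - 1 =
    8.\<close>
  then have dims: "A3.p.dim (Rel 1) = Suc (A3.p.dim (cross ` cube (W 0)))"
    "A3.p.dim (Rel 2) = Suc (A3.p.dim (cross ` cube (W 1)))"
    using dim_Rel[of 1] dim_Rel[of 2] dim_cross[of 0] dim_cross[of 1] dim_W0
    unfolding dim_W1 H2 dim_W0 colon_0 colon_1 W_0[symmetric] by simp_all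
  have incl: "cross ` cube (W 0) \<subseteq> Rel 1" "cross ` cube (W 1) \<subseteq> Rel 2"
    using cross_Rel[of 0] cross_Rel[of 1] by (simp_all add: numeral_2_eq_2)
  obtain t where t: "t \<in> Rel 1" "t \<notin> cross ` cube (W 0)"
    "\<And>u. u \<in> Rel 1 \<Longrightarrow> \<exists>r. u - A3.scale r t \<in> cross ` cube (W 0)"
    using A3.p.codim_one[OF subspace_cross subspace_Rel incl(1) dims(1)] by blast
  obtain t' where t': "t' \<in> Rel 2" "t' \<notin> cross ` cube (W 1)"
    "\<And>u. u \<in> Rel 2 \<Longrightarrow> \<exists>r. u - A3.scale r t' \<in> cross ` cube (W 1)"
    using A3.p.codim_one[OF subspace_cross subspace_Rel incl(2) dims(2)] by blast
  obtain Q1 Q2 Q3 where Q: "form 1 Q1" "form 1 Q2" "form 1 Q3" "t = (ev Q1, ev Q2, ev Q3)"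
    "form (Suc 1) (var 0 * Q1 + var 1 * Q2 + var 2 * Q3)" "ev (var 0 * Q1 + var 1 * Q2 + var 2 * Q3) = 0"
    by (rule Rel_E[OF t(1)])
  obtain C1 C2 C3 where C: "form 2 C1" "form 2 C2" "form 2 C3" "t' = (ev C1, ev C2, ev C3)"
    "form (Suc 2) (var 0 * C1 + var 1 * C2 + var 2 * C3)" "ev (var 0 * C1 + var 1 * C2 + var 2 * C3) = 0"
    by (rule Rel_E[OF t'(1)])
  define q c where "q = var 0 * Q1 + var 1 * Q2 + var 2 * Q3" and "c = var 0 * C1 + var 1 * C2 + var 2 * C3"
  have q: "form 2 q" "ev q = 0" and c: "form 3 c" "ev c = 0"
    using Q(5,6) C(5,6) by (simp_all add: q_def c_def numeral_2_eq_2 numeral_3_eq_3)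
  have "q \<noteq> 0"
    unfolding q_def using nonzero_of_not_cross[of 0 Q1 Q2 Q3] Q(1-4) t(2) by simp
  moreover have "c \<noteq> 0"
    unfolding c_def using nonzero_of_not_cross[of 1 C1 C2 C3] C(1-4) t'(2) by (simp add: numeral_2_eq_2)
  moreover have "ideal.span vanishing_forms = ideal.span {q, c}"
  proof (rule ideal.span_eq[THEN iffD2], intro conjI subsetI)
    fix F assume "F \<in> {q, c}"
    then have "F \<in> vanishing_forms" using q c by (auto simp: vanishing_forms_def)
    then show "F \<in> ideal.span vanishing_forms" by (rule ideal.span_base)
  next
    \<comment> \<open>Modulo \<open>q\<close> and \<open>c\<close>, a vanishing form can be
      rewritten so that its three coefficients, of lower degree, vanish as well.\<close>
    have "F \<in> ideal.span {q, c}" if "form d F" "ev F = 0" for d F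
      using that
    proof (induction d arbitrary: F)
      case 0
      then show ?case using form_0_ev_0 ideal.span_zero by blast
    next
      case (Suc d)
      obtain F1 F2 F3 where F: "form d F1" "form d F2" "form d F3" "F = var 0 * F1 + var 1 * F2 + var 2 * F3"
        using Suc.prems(1) by (rule form_decompose)
      have rel: "(ev F1, ev F2, ev F3) \<in> Rel d"
        using F Suc.prems(2) by (intro Rel_I) auto
      consider "d = 0" | "d = 1" | "d = 2" | "d \<ge> 3" by linarith
      then show ?case
      proof cases
        case 1
        then show ?thesis using form_1_ev_0[of F] Suc.prems ideal.span_zero by auto
      next
        case 2
        obtain r where "(ev F1, ev F2, ev F3) - A3.scale r (ev Q1, ev Q2, ev Q3) \<in> cross ` cube (W 0)"
          using t(3) rel Q(4) 2 by blast
        then obtain G1 G2 G3 where "form d G1" "form d G2" "form d G3" "ev G1 = 0" "ev G2 = 0" "ev G3 = 0"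
          and F_eq: "F = (var 0 * G1 + var 1 * G2 + var 2 * G3) + Poly_Mapping.single 0 r * q"
          using lift_relation[of d F1 F2 F3 0 r Q1 Q2 Q3] F Q(1-3) 2 unfolding q_def by auto
        then have "var 0 * G1 + var 1 * G2 + var 2 * G3 \<in> ideal.span {q, c}"
          by (intro var_combination_in_span Suc.IH)
        moreover have "Poly_Mapping.single 0 r * q \<in> ideal.span {q, c}"
          by (intro ideal.span_scale ideal.span_base) simp
        ultimately show ?thesis unfolding F_eq by (rule ideal.span_add)
      next
        case 3
        obtain r where "(ev F1, ev F2, ev F3) - A3.scale r (ev C1, ev C2, ev C3) \<in> cross ` cube (W 1)"
          using t'(3) rel C(4) 3 by blast
        then obtain G1 G2 G3 where "form d G1" "form d G2" "form d G3" "ev G1 = 0" "ev G2 = 0" "ev G3 = 0"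
          and F_eq: "F = (var 0 * G1 + var 1 * G2 + var 2 * G3) + Poly_Mapping.single 0 r * c"
          using lift_relation[of d F1 F2 F3 1 r C1 C2 C3] F C(1-3) 3 unfolding c_def by auto
        then have "var 0 * G1 + var 1 * G2 + var 2 * G3 \<in> ideal.span {q, c}"
          by (intro var_combination_in_span Suc.IH)
        moreover have "Poly_Mapping.single 0 r * c \<in> ideal.span {q, c}"
          by (intro ideal.span_scale ideal.span_base) simp
        ultimately show ?thesis unfolding F_eq by (rule ideal.span_add)
      next
        case 4
        then have "(ev F1, ev F2, ev F3) - A3.scale 0 (ev 0, ev 0, ev 0) \<in> cross ` cube (W (d - 1))"
          using Rel_ge_3 rel by (auto simp: zero_prod_def[symmetric])
        then obtain G1 G2 G3 where "form d G1" "form d G2" "form d G3" "ev G1 = 0" "ev G2 = 0" "ev G3 = 0"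
          and F_eq: "F = var 0 * G1 + var 1 * G2 + var 2 * G3"
          using lift_relation[of d F1 F2 F3 "d - 1" 0 0 0 0] F 4 by auto
        then have "var 0 * G1 + var 1 * G2 + var 2 * G3 \<in> ideal.span {q, c}"
          by (intro var_combination_in_span Suc.IH)
        then show ?thesis unfolding F_eq .
      qed
    qed
    then show "F \<in> ideal.span {q, c}" if "F \<in> vanishing_forms" for F
      using that by (auto simp: vanishing_forms_def)
  qed
  ultimately show thesis using that q(1) c(1) by blast
qed

end

section \<open>From a conic and a cubic to self-duality\<close>

text \<open>Up to sign, \<open>e\<close> below is the second difference of \<open>H\<close>. It does not increase from degree 1 on and
  is eventually zero, hence nonnegative there; the two slack units in degrees 2 and 3 come from the
  conic and the cubic.\<close>

lemma hilbert_function_2_3: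
  fixes H :: "nat \<Rightarrow> nat"
  assumes H0: "H 0 = 1" and H1: "H 1 = 3" and H2: "3 * H 1 \<le> H 2 + 4"
    and H3: "3 * H 2 + H 0 \<le> H 3 + 3 * H 1 + 1"
    and step: "\<And>d. 3 * H (d + 3) + H (d + 1) \<le> H (d + 4) + 3 * H (d + 2)"
    and const: "\<And>d. d \<ge> D \<Longrightarrow> H d = N"
  shows "H 2 = 5" "H 3 = 6" "N = 6"
proof -
  define e where "e d = 2 * int (H (d + 1)) - int (H d) - int (H (d + 2))" for d
  have e_mono: "e (Suc d) \<ge> e (Suc (Suc d))" for d
    using step[of d] by (simp add: e_def numeral_eq_Suc)
  have e_anti: "e (Suc d) \<ge> e (Suc (d + n))" for d n
    by (induction n) (use e_mono order_trans in \<open>auto intro: order_trans\<close>)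
  have e_nonneg: "e (Suc d) \<ge> 0" for d
    using e_anti[of d D] const[of "Suc (d + D)"] const[of "Suc (Suc (d + D))"] const[of "Suc (Suc (Suc (d + D)))"]
    by (simp add: e_def)
  have diff: "int (H (d + 2)) - int (H (d + 1)) = int (H (d + 1)) - int (H d) - e d" for d
    by (simp add: e_def)
  \<comment> \<open>Once \<open>e\<close> vanishes in a positive degree it stays zero, so
    \<open>H\<close> has constant slope from there on; as \<open>H\<close> is eventually constant,
    that slope is zero.\<close>
  have stable: "int (H (d + n + 3)) - int (H (d + n + 2)) = int (H (d + 2)) - int (H (d + 1))"
    if "e (Suc d) = 0" for d n
  proof (induction n)
    case 0
    then show ?case using diff[of "Suc d"] that by (simp add: numeral_eq_Suc)
  next
    case (Suc n)
    have "e (Suc (d + Suc n)) = 0" using e_anti[of d "Suc n"] e_nonneg[of "d + Suc n"] that by simp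
    then show ?case using diff[of "Suc (d + Suc n)"] Suc by (simp add: numeral_eq_Suc)
  qed
  have flat: "H (d + 2) = H (d + 1)" if "e (Suc d) = 0" for d
    using stable[OF that, of D] const[of "d + D + 3"] const[of "d + D + 2"] by simp
  have later: "H (d + n) = H d" if "H (Suc d) = H d" "\<And>m. e (d + m) = 0" for d n
  proof -
    have "H (Suc (d + n)) = H (d + n)" for n
    proof (induction n)
      case 0 then show ?case using that by simp
    next
      case (Suc n)
      then show ?case using diff[of "d + n"] that(2)[of n] by simp
    qed
    then show ?thesis by (induction n) simp_all
  qed
  have e0: "e 0 \<le> 0" "e 1 \<le> e 0 + 1"
    using H0 H1 H2 H3 by (simp_all add: e_def numeral_eq_Suc)
  have e1: "e 1 = 1"
  proof (rule ccontr)
    assume "e 1 \<noteq> 1"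
    then have "e (Suc 0) = 0" using e0 e_nonneg[of 0] by simp
    from flat[OF this] show False using H1 H2 by (simp add: numeral_2_eq_2)
  qed
  then have "e 0 = 0" using e0 by simp
  then show H2': "H 2 = 5" using H0 H1 by (simp add: e_def numeral_eq_Suc)
  then show H3': "H 3 = 6" using e1 H1 by (simp add: e_def numeral_eq_Suc)
  have "e 2 \<noteq> 0"
  proof
    assume "e 2 = 0"
    then have "e (Suc 1) = 0" by (simp add: numeral_2_eq_2)
    from flat[OF this] show False using H2' H3' by (simp add: numeral_eq_Suc)
  qed
  moreover have "e 2 \<ge> 0" "e 2 \<le> 1" using e_nonneg[of 1] e_mono[of 0] e1 by (simp_all add: numeral_2_eq_2)
  ultimately have "e 2 = 1" by simp
  then have H4: "H 4 = 6" using H2' H3' by (simp add: e_def numeral_eq_Suc)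
  have "H (d + 4) = 6 \<and> H (d + 3) = 6" for d
  proof (induction d)
    case 0
    then show ?case using H3' H4 by simp
  next
    case (Suc d)
    \<comment> \<open>Otherwise \<open>H\<close> would drop by at least one at every later
      step.\<close>
    have "e (d + 3) = 0"
    proof (rule ccontr)
      assume "e (d + 3) \<noteq> 0"
      then have pos: "e (d + 3) \<ge> 1" using e_nonneg[of "d + 2"] by (simp add: numeral_eq_Suc)
      have "int (H (d + 5 + n)) - int (H (d + 4 + n)) \<le> -1" for n
      proof (induction n)
        case 0
        then show ?case using diff[of "d + 3"] pos Suc by (simp add: numeral_eq_Suc)
      next
        case (Suc n)
        then show ?case using diff[of "d + 4 + n"] e_nonneg[of "d + 3 + n"] by (simp add: numeral_eq_Suc)
      qed
      from this[of D] show False using const[of "d + 5 + D"] const[of "d + 4 + D"] by simp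
    qed
    then show ?case using diff[of "d + 3"] Suc by (simp add: numeral_eq_Suc)
  qed
  then show "N = 6" using const[of "D + 3"] by (metis le_add1)
qed

context plane_algebra begin

lemma module_combination_in_span2:
  "F \<in> ideal.span {q, c} \<longleftrightarrow> (\<exists>P R. F = P * q + R * c)" for F q c :: "(3, 'k) mpoly"
proof -
  have "F \<in> ideal.span {q, c} \<longleftrightarrow> (\<exists>P. F - P * q \<in> range (\<lambda>R. R * c))"
    by (simp add: ideal.span_insert[of q] ideal.span_singleton)
  then show ?thesis by (auto simp: image_iff diff_eq_eq add.commute)
qed

end

locale conic_cubic_plane_algebra = plane_algebra \<iota> crd
  for \<iota> :: "'k::field \<Rightarrow> 'a::comm_ring_1" and crd :: "3 \<Rightarrow> 'a" +
  fixes q c :: "(3, 'k) mpoly"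
  assumes q: "form 2 q" and c: "form 3 c"
    and generators: "ideal.span vanishing_forms = ideal.span {q, c}"
begin

lemma ev_generator: "F \<in> {q, c} \<Longrightarrow> ev F = 0"
proof -
  have "ev G = 0" if "G \<in> ideal.span vanishing_forms" for G
    using that
  proof (induction rule: ideal.span_induct_alt)
    case base
    then show ?case by simp
  next
    case (step P G' G)
    then show ?case by (auto simp: vanishing_forms_def ev_simps)
  qed
  then show "F \<in> {q, c} \<Longrightarrow> ev F = 0" unfolding generators using ideal.span_base by blast
qed

text \<open>The component of degree \<open>d\<close> of any expression in \<open>q\<close> and
  \<open>c\<close> is again such an expression, now with homogeneous coefficients. The last two
  conclusions cover the low degrees, where \<open>d - 2\<close> and \<open>d - 3\<close> are
  truncated.\<close>

lemma vanishing_form_E: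
  assumes F: "form d F" "ev F = 0"
  obtains P R where "F = P * q + R * c" "form (d - 2) P" "form (d - 3) R" "d < 2 \<Longrightarrow> P = 0" "d < 3 \<Longrightarrow> R = 0"
proof -
  have "F \<in> ideal.span vanishing_forms"
    using F by (intro ideal.span_base) (auto simp: vanishing_forms_def)
  then obtain P R where "F = P * q + R * c"
    unfolding generators module_combination_in_span2 by blast
  then have "hcomp d F = hcomp d (P * q) + hcomp d (R * c)" by (simp add: hcomp_add)
  then have "F = (if d < 2 then 0 else hcomp (d - 2) P) * q + (if d < 3 then 0 else hcomp (d - 3) R) * c"
    using hcomp_form[OF F(1), of d] by (simp add: hcomp_mult[OF q] hcomp_mult[OF c])
  then show thesis by (rule that) (auto simp: form_hcomp)
qed

text \<open>A relation gives a vanishing form \<open>P * q + R * c\<close>. Subtracting from its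
  coefficients those that the decompositions of the factors provide leaves a relation between
  polynomials, which is Koszul by \<open>koszul_poly\<close>. As \<open>q\<close> and
  \<open>c\<close> vanish at the coordinates, only multipliers of degree zero leave a trace in the
  values.\<close>

lemma Rel_1: "\<exists>t. \<forall>u\<in>Rel 1. \<exists>r. u - A3.scale r t \<in> cross ` cube (W 0)"
  and Rel_2: "\<exists>t. \<forall>u\<in>Rel 2. \<exists>r. u - A3.scale r t \<in> cross ` cube (W 1)"
  and Rel_ge_3: "d \<ge> 3 \<Longrightarrow> Rel d \<subseteq> cross ` cube (W (d - 1))"
proof -
  have cross_I: "(ev F1, ev F2, ev F3) \<in> cross ` cube (W m)"
    if zero: "var 0 * F1 + var 1 * F2 + var 2 * F3 = 0" and "form (Suc m) F1" "form (Suc m) F2" "form (Suc m) F3"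
    for F1 F2 F3 m
  proof (rule ccontr)
    assume "\<not> ?thesis"
    then show False using nonzero_of_not_cross that by blast
  qed
  have zq: "ev q = 0" and zc: "ev c = 0" using ev_generator by simp_all
  have "form (Suc 1) q" "form (Suc 2) c" using q c by (simp_all add: numeral_2_eq_2 numeral_3_eq_3)
  then obtain Q1 Q2 Q3 C1 C2 C3 where Q: "form 1 Q1" "form 1 Q2" "form 1 Q3" "q = var 0 * Q1 + var 1 * Q2 + var 2 * Q3"
    and C: "form 2 C1" "form 2 C2" "form 2 C3" "c = var 0 * C1 + var 1 * C2 + var 2 * C3"
    using form_decompose by metis
  have scale: "form n (Poly_Mapping.single 0 r * G)" if "form n G" for n r and G :: "(3, 'k) mpoly"
    using form_mult[OF form_const that] by simp
  show "\<exists>t. \<forall>u\<in>Rel 1. \<exists>r. u - A3.scale r t \<in> cross ` cube (W 0)"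
  proof (intro exI[of _ "(ev Q1, ev Q2, ev Q3)"] ballI)
    fix u assume "u \<in> Rel 1"
    then obtain F1 F2 F3 where F: "form 1 F1" "form 1 F2" "form 1 F3" "u = (ev F1, ev F2, ev F3)"
      "form (Suc 1) (var 0 * F1 + var 1 * F2 + var 2 * F3)" "ev (var 0 * F1 + var 1 * F2 + var 2 * F3) = 0"
      by (rule Rel_E)
    obtain P R where P: "var 0 * F1 + var 1 * F2 + var 2 * F3 = P * q + R * c" "form (Suc 1 - 2) P"
        "Suc 1 < 3 \<Longrightarrow> R = 0"
      using vanishing_form_E[OF F(5,6)] by metis
    obtain r where r: "P = Poly_Mapping.single 0 r" using P(2) form_0D by auto
    have "var 0 * (F1 - P * Q1) + var 1 * (F2 - P * Q2) + var 2 * (F3 - P * Q3)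
        = (var 0 * F1 + var 1 * F2 + var 2 * F3) - P * q"
      unfolding Q(4) by (simp add: right_diff_distrib distrib_left mult.left_commute[of P])
    then have "var 0 * (F1 - P * Q1) + var 1 * (F2 - P * Q2) + var 2 * (F3 - P * Q3) = 0"
      using P by simp
    then have "(ev (F1 - P * Q1), ev (F2 - P * Q2), ev (F3 - P * Q3)) \<in> cross ` cube (W 0)"
      using F Q unfolding r by (intro cross_I form_diff scale) auto
    then have "u - A3.scale r (ev Q1, ev Q2, ev Q3) \<in> cross ` cube (W 0)"
      unfolding F(4) by (simp add: ev_simps r del: poly_value_single)
    then show "\<exists>r. u - A3.scale r (ev Q1, ev Q2, ev Q3) \<in> cross ` cube (W 0)" by blast
  qed
  show "\<exists>t. \<forall>u\<in>Rel 2. \<exists>r. u - A3.scale r t \<in> cross ` cube (W 1)"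
  proof (intro exI[of _ "(ev C1, ev C2, ev C3)"] ballI)
    fix u assume "u \<in> Rel 2"
    then obtain F1 F2 F3 where F: "form 2 F1" "form 2 F2" "form 2 F3" "u = (ev F1, ev F2, ev F3)"
      "form (Suc 2) (var 0 * F1 + var 1 * F2 + var 2 * F3)" "ev (var 0 * F1 + var 1 * F2 + var 2 * F3) = 0"
      by (rule Rel_E)
    obtain P R where P: "var 0 * F1 + var 1 * F2 + var 2 * F3 = P * q + R * c" "form (Suc 2 - 2) P" "form (Suc 2 - 3) R"
      using vanishing_form_E[OF F(5,6)] by metis
    obtain r where r: "R = Poly_Mapping.single 0 r" using P(3) form_0D by auto
    have "form (Suc 0) P" using P(2) by (simp add: numeral_2_eq_2)
    then obtain P1 P2 P3 where P': "form 0 P1" "form 0 P2" "form 0 P3" "P = var 0 * P1 + var 1 * P2 + var 2 * P3"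
      by (rule form_decompose)
    have Pq: "form 2 (P1 * q)" "form 2 (P2 * q)" "form 2 (P3 * q)"
      using form_mult[OF P'(1) q] form_mult[OF P'(2) q] form_mult[OF P'(3) q] by (simp_all only: add_0)
    have "var 0 * (F1 - P1 * q - R * C1) + var 1 * (F2 - P2 * q - R * C2) + var 2 * (F3 - P3 * q - R * C3)
        = (var 0 * F1 + var 1 * F2 + var 2 * F3) - (P * q + R * c)"
      unfolding P'(4) C(4)
      by (simp add: right_diff_distrib distrib_left distrib_right mult.assoc mult.left_commute[of R])
    then have "(ev (F1 - P1 * q - R * C1), ev (F2 - P2 * q - R * C2), ev (F3 - P3 * q - R * C3)) \<in> cross ` cube (W 1)"
      using F C Pq unfolding P(1) r by (intro cross_I form_diff scale) (auto simp: numeral_2_eq_2)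
    then have "u - A3.scale r (ev C1, ev C2, ev C3) \<in> cross ` cube (W 1)"
      unfolding F(4) by (simp add: ev_simps r zq del: poly_value_single)
    then show "\<exists>r. u - A3.scale r (ev C1, ev C2, ev C3) \<in> cross ` cube (W 1)" by blast
  qed
  show "Rel d \<subseteq> cross ` cube (W (d - 1))" if d: "d \<ge> 3"
  proof
    fix u assume "u \<in> Rel d"
    then obtain F1 F2 F3 where F: "form d F1" "form d F2" "form d F3" "u = (ev F1, ev F2, ev F3)"
      "form (Suc d) (var 0 * F1 + var 1 * F2 + var 2 * F3)" "ev (var 0 * F1 + var 1 * F2 + var 2 * F3) = 0"
      by (rule Rel_E)
    obtain P R where P: "var 0 * F1 + var 1 * F2 + var 2 * F3 = P * q + R * c" "form (Suc d - 2) P" "form (Suc d - 3) R"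
      using vanishing_form_E[OF F(5,6)] by metis
    have "Suc d - 2 = Suc (d - 2)" "Suc d - 3 = Suc (d - 3)" using d by simp_all
    then have "form (Suc (d - 2)) P" "form (Suc (d - 3)) R" using P(2,3) by simp_all
    then obtain P1 P2 P3 R1 R2 R3 where P': "form (d - 2) P1" "form (d - 2) P2" "form (d - 2) P3"
        "P = var 0 * P1 + var 1 * P2 + var 2 * P3"
      and R': "form (d - 3) R1" "form (d - 3) R2" "form (d - 3) R3" "R = var 0 * R1 + var 1 * R2 + var 2 * R3"
      using form_decompose by metis
    have d': "d - 2 + 2 = d" "d - 3 + 3 = d" using d by simp_all
    have Pq: "form d (P1 * q)" "form d (P2 * q)" "form d (P3 * q)"
      using form_mult[OF P'(1) q] form_mult[OF P'(2) q] form_mult[OF P'(3) q] by (simp_all only: d')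
    have Rc: "form d (R1 * c)" "form d (R2 * c)" "form d (R3 * c)"
      using form_mult[OF R'(1) c] form_mult[OF R'(2) c] form_mult[OF R'(3) c] by (simp_all only: d')
    have "var 0 * (F1 - P1 * q - R1 * c) + var 1 * (F2 - P2 * q - R2 * c) + var 2 * (F3 - P3 * q - R3 * c)
        = (var 0 * F1 + var 1 * F2 + var 2 * F3) - (P * q + R * c)"
      unfolding P'(4) R'(4) by (simp add: right_diff_distrib distrib_left distrib_right mult.assoc)
    then have "(ev (F1 - P1 * q - R1 * c), ev (F2 - P2 * q - R2 * c), ev (F3 - P3 * q - R3 * c)) \<in> cross ` cube (W (d - 1))"
      using F Pq Rc d unfolding P(1) by (intro cross_I form_diff) auto
    then show "u \<in> cross ` cube (W (d - 1))"
      unfolding F(4) by (simp add: ev_simps zq zc)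
  qed
qed

text \<open>\<open>dim_Rel\<close> and \<open>dim_cross\<close> turn the bounds on relations into
  the inequalities of \<open>hilbert_function_2_3\<close>; \<open>W_colon\<close> bounds the kernel
  of \<open>cross\<close> from below.\<close>

lemma Hilbert_function: "H 2 = 5" "W 3 = UNIV" "A.dim UNIV = 6"
proof -
  obtain D where D: "W D = UNIV" using ex_W_UNIV by blast
  have const: "H d = A.dim UNIV" if "d \<ge> D" for d using W_UNIV_mono[OF that D] by simp
  have colon_le: "H d \<le> A.dim (colon (Suc d))" for d
    by (rule A.dim_subset) (rule W_colon)
  have "3 * H 1 \<le> H 2 + 4"
  proof -
    obtain t where "\<forall>u\<in>Rel 1. \<exists>r. u - A3.scale r t \<in> cross ` cube (W 0)" using Rel_1 by blast
    then have "A3.p.dim (Rel 1) \<le> Suc (A3.p.dim (cross ` cube (W 0)))" by (intro A3.p.dim_le_Suc) blast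
    then show ?thesis using dim_Rel[of 1] dim_cross[of 0] dim_W0 by (simp add: numeral_2_eq_2)
  qed
  moreover have "3 * H 2 + H 0 \<le> H 3 + 3 * H 1 + 1"
  proof -
    obtain t where "\<forall>u\<in>Rel 2. \<exists>r. u - A3.scale r t \<in> cross ` cube (W 1)" using Rel_2 by blast
    then have "A3.p.dim (Rel 2) \<le> Suc (A3.p.dim (cross ` cube (W 1)))" by (intro A3.p.dim_le_Suc) blast
    then show ?thesis using dim_Rel[of 2] dim_cross[of 1] colon_le[of 0] by (simp add: numeral_3_eq_3)
  qed
  moreover have "3 * H (d + 3) + H (d + 1) \<le> H (d + 4) + 3 * H (d + 2)" for d
  proof -
    have "A3.p.dim (Rel (d + 3)) \<le> A3.p.dim (cross ` cube (W (d + 2)))"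
      using Rel_ge_3[of "d + 3"] by (intro A3.p.dim_subset) simp
    then show ?thesis using dim_Rel[of "d + 3"] dim_cross[of "d + 2"] colon_le[of "d + 1"]
      by (simp add: numeral_eq_Suc)
  qed
  ultimately have H: "H 2 = 5" "H 3 = 6" "A.dim UNIV = 6"
    using hilbert_function_2_3[OF dim_W0 dim_W1 _ _ _ const] by blast+
  then show "H 2 = 5" "A.dim UNIV = 6" by auto
  show "W 3 = UNIV"
    using A.subspace_dim_equal[OF subspace_W A.subspace_UNIV subset_UNIV] H by simp
qed

text \<open>The functional with kernel the products of linear forms is a dual generator: the exactness of
  the Koszul relations in degree four says that every functional on the space of linear forms is
  \<open>v \<mapsto> \<phi> (h v)\<close>.\<close>

lemma dual_generator:
  obtains \<phi> where "Vector_Spaces.linear sc (*) \<phi>" "\<And>h. (\<And>u. \<phi> (h * u) = 0) \<Longrightarrow> h = 0" "perp \<phi> = W 1"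
proof -
  have "W 2 \<noteq> UNIV" using Hilbert_function by auto
  then obtain f where "f \<notin> W 2" by blast
  obtain \<phi> where \<phi>: "Vector_Spaces.linear sc (*) \<phi>" "\<And>u. u \<in> W 2 \<Longrightarrow> \<phi> u = 0" "\<phi> f = 1"
    using A.separating_functional[OF subspace_W \<open>f \<notin> W 2\<close>] by blast
  interpret \<phi>: Vector_Spaces.linear sc "(*)" \<phi> by (rule \<phi>(1))
  have onto: "\<exists>h. \<phi> (h * x) = r \<and> \<phi> (h * y) = s \<and> \<phi> (h * z) = t" for r s t
  proof -
    \<comment> \<open>As \<open>W 3\<close> is the whole algebra, \<open>cross ?g\<close> lies in
      \<open>Rel 3\<close> and comes from a triple \<open>g'\<close> in \<open>W 2\<close>. The
      difference \<open>?g - g'\<close> is a multiple h (x, y, z), on which \<phi> takes the values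
      r, s, t because \<phi> kills \<open>W 2\<close> and \<open>\<phi> f = 1\<close>.\<close>
    let ?g = "(\<iota> r * f, \<iota> s * f, \<iota> t * f)"
    have "cross ?g \<in> Rel 3" unfolding Rel_def using Hilbert_function(2) dot_cross by auto
    then obtain g' where g': "g' \<in> cube (W 2)" "cross ?g = cross g'" using Rel_ge_3[of 3] by auto
    interpret cr: Vector_Spaces.linear A3.scale A3.scale cross by (rule linear_cross)
    have "cross (?g - g') = 0" unfolding cr.diff using g'(2) by simp
    then obtain h where h: "?g - g' = (h * x, h * y, h * z)" by (rule koszul_cross)
    obtain a1 a2 a3 where a: "g' = (a1, a2, a3)" "a1 \<in> W 2" "a2 \<in> W 2" "a3 \<in> W 2" using g'(1) by auto
    have "h * x = \<iota> r * f - a1" "h * y = \<iota> s * f - a2" "h * z = \<iota> t * f - a3" using h a(1) by auto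
    then show ?thesis using a(2-4) \<phi>(2,3) by (intro exI[of _ h]) (simp add: \<phi>.diff \<phi>.scale)
  qed
  have "W 1 \<subseteq> perp \<phi>"
  proof
    fix h assume h: "h \<in> W 1"
    have "\<phi> (h * crd i) = 0" for i using W_mult[OF h crd_in_W1, of i] \<phi>(2) by (simp add: numeral_2_eq_2)
    then show "h \<in> perp \<phi>" by (simp add: perp_def)
  qed
  moreover have "A.subspace (perp \<phi>)"
    unfolding perp_def by (rule A.subspaceI) (auto simp: distrib_right mult.assoc \<phi>.add \<phi>.scale)
  moreover have "A.dim (perp \<phi>) = 3" using dim_perp[OF \<phi>(1) onto] Hilbert_function(3) by simp
  ultimately have perp: "perp \<phi> = W 1"
    using A.subspace_dim_equal[OF subspace_W, of "perp \<phi>" 1] dim_W1 by simp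
  \<comment> \<open>Such an h is orthogonal to the linear forms, hence linear, and
    \<open>onto\<close> then forces its three coefficients to be zero.\<close>
  have "h = 0" if h: "\<And>u. \<phi> (h * u) = 0" for h
  proof -
    have "h \<in> perp \<phi>" using h by (simp add: perp_def)
    then obtain r s t where rst: "h = \<iota> r * x + \<iota> s * y + \<iota> t * z" unfolding perp by (rule W1_E)
    have eq: "r * \<phi> (g * x) + s * \<phi> (g * y) + t * \<phi> (g * z) = 0" for g
    proof -
      have "h * g = \<iota> r * (g * x) + \<iota> s * (g * y) + \<iota> t * (g * z)" unfolding rst by (simp add: algebra_simps)
      then show ?thesis using h[of g] by (simp add: \<phi>.add \<phi>.scale)
    qed
    obtain g1 g2 g3 where "\<phi> (g1 * x) = 1" "\<phi> (g1 * y) = 0" "\<phi> (g1 * z) = 0"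
      "\<phi> (g2 * x) = 0" "\<phi> (g2 * y) = 1" "\<phi> (g2 * z) = 0" "\<phi> (g3 * x) = 0" "\<phi> (g3 * y) = 0" "\<phi> (g3 * z) = 1"
      using onto by metis
    then have "r = 0" "s = 0" "t = 0" using eq[of g1] eq[of g2] eq[of g3] by simp_all
    then show "h = 0" using rst by simp
  qed
  then show thesis using that \<phi>(1) perp by blast
qed

end

section \<open>Line bundles on finite schemes are trivial\<close>

context finite_algebra begin

lemma subspace_multiples: "A.subspace (range ((*) u))"
  by (rule A.subspaceI) (auto simp: image_iff distrib_left[symmetric] mult.left_commute[of "\<iota> _"]
      intro: exI[of _ 0])

text \<open>The ideals generated by the powers of \<open>f\<close> decrease, so they stabilize by
  dimension: \<open>f ^ n = f ^ Suc n * g\<close>. It follows that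
  \<open>f ^ N = f ^ N * f ^ N * g ^ N\<close>, and \<open>g ^ N * f ^ N\<close> is an idempotent
  generating the same ideal as \<open>f ^ N\<close>.\<close>

lemma power_idempotent:
  fixes f :: 'a
  obtains e N k where "e * e = e" "e = k * f ^ N" "e * f ^ N = f ^ N" "N \<noteq> 0"
proof -
  obtain n where n: "\<And>m. A.dim (range ((*) (f ^ n))) \<le> A.dim (range ((*) (f ^ m)))"
    using ex_has_least_nat[of "\<lambda>_. True" _ "\<lambda>n. A.dim (range ((*) (f ^ n)))"] by blast
  have "f ^ Suc n * u = f ^ n * (f * u)" for u by (simp only: power_Suc mult_ac)
  then have "range ((*) (f ^ Suc n)) \<subseteq> range ((*) (f ^ n))" by blast
  then have "range ((*) (f ^ Suc n)) = range ((*) (f ^ n))"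
    using n[of "Suc n"] by (intro A.subspace_dim_equal subspace_multiples)
  moreover have "f ^ n \<in> range ((*) (f ^ n))" using rangeI[of "(*) (f ^ n)" 1] by simp
  ultimately obtain g where g: "f ^ n = f ^ Suc n * g" by blast
  have step: "f ^ Suc n = f ^ (Suc n + k) * g ^ k" for k
  proof (induction k)
    case (Suc k)
    have "f ^ Suc n = f ^ (Suc k) * (f ^ n) * g ^ k" using Suc by (simp add: power_add algebra_simps)
    also have "\<dots> = f ^ (Suc n + Suc k) * g ^ Suc k" unfolding g by (simp add: power_add algebra_simps)
    finally show ?case .
  qed simp
  \<comment> \<open>The successor ensures \<open>N \<noteq> 0\<close>, so that the idempotent will
    be divisible by every power of \<open>f\<close>.\<close>
  define N where "N = Suc n"
  have N: "f ^ N = f ^ N * f ^ N * g ^ N" using step[of N] by (simp add: N_def[symmetric] power_add)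
  show thesis
  proof (rule that[of "g ^ N * f ^ N" "g ^ N" N])
    have "g ^ N * f ^ N * (g ^ N * f ^ N) = g ^ N * (f ^ N * f ^ N * g ^ N)" by (simp only: mult_ac)
    then show "g ^ N * f ^ N * (g ^ N * f ^ N) = g ^ N * f ^ N" by (simp only: N[symmetric])
    have "g ^ N * f ^ N * f ^ N = f ^ N * f ^ N * g ^ N" by (simp only: mult_ac)
    then show "g ^ N * f ^ N * f ^ N = f ^ N" by (simp only: N[symmetric])
  qed (simp_all add: N_def)
qed

end

text \<open>For an idempotent \<open>e\<close>, the restriction of the module to the open and closed subscheme
  \<open>D(e)\<close> is free of rank one, with generator \<open>g\<close>.\<close>

definition trivial_on :: "('a::comm_ring_1 \<Rightarrow> 'l::ab_group_add \<Rightarrow> 'l) \<Rightarrow> 'a \<Rightarrow> bool"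
  where "trivial_on act e \<longleftrightarrow> e * e = e \<and>
    (\<exists>g. act e g = g \<and> (\<forall>l. \<exists>a. act e l = act a g) \<and> (\<forall>a. act a g = 0 \<longrightarrow> a * e = 0))"

context
  fixes act :: "'a::comm_ring_1 \<Rightarrow> 'l::ab_group_add \<Rightarrow> 'l"
  assumes "module act"
begin

interpretation M: module act by fact

lemma trivial_on_zero: "trivial_on act 0"
  unfolding trivial_on_def by (auto intro!: exI[of _ 0])

lemma trivial_on_mult:
  assumes "trivial_on act e" and e': "e' * e' = e'"
  shows "trivial_on act (e * e')"
proof -
  obtain g where e: "e * e = e" and g: "act e g = g" "\<And>l. \<exists>a. act e l = act a g"
    "\<And>a. act a g = 0 \<Longrightarrow> a * e = 0"
    using assms(1) unfolding trivial_on_def by blast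
  show ?thesis
    unfolding trivial_on_def
  proof (intro conjI exI[of _ "act e' g"] allI impI)
    have "e * e' * (e * e') = (e * e) * (e' * e')" by (simp only: mult_ac)
    then show "e * e' * (e * e') = e * e'" by (simp only: e e')
    have "e * e' * e' = e' * e" using e' by (metis mult.assoc mult.commute)
    then have "act (e * e') (act e' g) = act e' (act e g)" by (simp only: M.scale_scale)
    then show "act (e * e') (act e' g) = act e' g" by (simp only: g(1))
    show "\<exists>a. act (e * e') l = act a (act e' g)" for l
    proof -
      obtain a where a: "act e l = act a g" using g(2) by blast
      have "act (e * e') l = act e' (act e l)" by (simp only: M.scale_scale mult.commute)
      also have "\<dots> = act a (act e' g)" by (simp only: a M.scale_scale mult.commute)
      finally show ?thesis by blast
    qed
    show "a * (e * e') = 0" if "act a (act e' g) = 0" for a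
    proof -
      have "a * e' * e = 0" using that by (intro g(3)) (simp only: M.scale_scale)
      then show ?thesis by (simp only: mult_ac)
    qed
  qed
qed

text \<open>On two disjoint open and closed subschemes the generators glue to their sum, since
  orthogonality makes each idempotent kill the generator of the other.\<close>

lemma trivial_on_add:
  assumes "trivial_on act e" "trivial_on act e'" and orth: "e * e' = 0"
  shows "trivial_on act (e + e')"
proof -
  obtain g where e: "e * e = e" and g: "act e g = g" "\<And>l. \<exists>a. act e l = act a g"
    "\<And>a. act a g = 0 \<Longrightarrow> a * e = 0"
    using assms(1) unfolding trivial_on_def by blast
  obtain g' where e': "e' * e' = e'" and g': "act e' g' = g'" "\<And>l. \<exists>a. act e' l = act a g'"
    "\<And>a. act a g' = 0 \<Longrightarrow> a * e' = 0"
    using assms(2) unfolding trivial_on_def by blast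
  have orth': "e' * e = 0" using orth by (simp add: mult.commute)
  have gg': "act e g' = 0" "act e' g = 0"
    using arg_cong[OF g'(1), of "act e"] arg_cong[OF g(1), of "act e'"] by (simp_all add: orth orth')
  show ?thesis
    unfolding trivial_on_def
  proof (intro conjI exI[of _ "g + g'"] allI impI)
    show "(e + e') * (e + e') = e + e'" by (simp add: distrib_left distrib_right e e' orth orth')
    show "act (e + e') (g + g') = g + g'"
      by (simp add: M.scale_left_distrib M.scale_right_distrib g(1) g'(1) gg')
    show "\<exists>a. act (e + e') l = act a (g + g')" for l
    proof -
      obtain a b where ab: "act e l = act a g" "act e' l = act b g'" using g(2) g'(2) by meson
      have "act (a * e) g = act a g" "act (b * e') g' = act b g'"
        "act (a * e) g' = 0" "act (b * e') g = 0"
        unfolding M.scale_scale[symmetric] by (simp_all only: g(1) g'(1) gg' M.scale_zero_right)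
      then have "act (e + e') l = act (a * e + b * e') (g + g')"
        by (simp add: M.scale_left_distrib M.scale_right_distrib ab)
      then show ?thesis by blast
    qed
    show "a * (e + e') = 0" if a: "act a (g + g') = 0" for a
    proof -
      have "act (a * e) (g + g') = act e (act a (g + g'))" "act (a * e') (g + g') = act e' (act a (g + g'))"
        by (simp_all only: M.scale_scale mult.commute)
      then have "act (a * e) (g + g') = 0" "act (a * e') (g + g') = 0" using a by simp_all
      moreover have "act (a * e) (g + g') = act a g" "act (a * e') (g + g') = act a g'"
        unfolding M.scale_scale[symmetric] by (simp_all only: M.scale_right_distrib g(1) g'(1) gg' add_0 add_0_right M.scale_zero_right)
      ultimately show ?thesis using g(3) g'(3) by (simp add: distrib_left)
    qed
  qed
qed

end

context finite_algebra begin

text \<open>An idempotent \<open>e\<close> with \<open>L\<close> trivial on \<open>D(e)\<close> and \<open>(1 - e) A\<close> of minimal dimension is \<open>1\<close>.\<close>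

lemma line_bundle_trivial:
  fixes scale :: "'a \<Rightarrow> 'l::ab_group_add \<Rightarrow> 'l"
  assumes "line_bundle scale"
  obtains g where "\<And>l. \<exists>a. l = scale a g" "\<And>a. scale a g = 0 \<Longrightarrow> a = 0"
proof -
  interpret L: module scale using assms by (simp add: line_bundle_def)
  obtain C where C: "ideal.span C = (UNIV :: 'a set)"
    and loc: "\<And>f. f \<in> C \<Longrightarrow> \<exists>e. (\<forall>l. \<exists>n a. scale (f ^ n) l = scale a e) \<and> (\<forall>a. scale a e = 0 \<longrightarrow> (\<exists>n. f ^ n * a = 0))"
    using assms unfolding line_bundle_def by blast
  have local: "\<exists>e N. trivial_on scale e \<and> e * f ^ N = f ^ N" if f: "f \<in> C" for f
  proof -
    obtain e0 where e0: "\<And>l. \<exists>n a. scale (f ^ n) l = scale a e0" "\<And>a. scale a e0 = 0 \<Longrightarrow> \<exists>n. f ^ n * a = 0"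
      using loc[OF f] by blast
    obtain e N k where e: "e * e = e" "e = k * f ^ N" "e * f ^ N = f ^ N" "N \<noteq> 0" by (rule power_idempotent)
    \<comment> \<open>An idempotent equals its own powers, so with \<open>f ^ N\<close> all powers
      of \<open>f\<close> divide it. This clears the denominators in the local
      trivialization.\<close>
    have e_pow: "\<exists>w. e = w * f ^ n" for n
    proof -
      have "e = e ^ Suc m" for m by (induction m) (use e(1) in simp_all)
      then have "e = (k * f ^ N) ^ Suc n" using e(2) by metis
      also have "\<dots> = k ^ Suc n * f ^ (N * Suc n)" by (simp only: power_mult_distrib power_mult)
      also have "N * Suc n = (N * Suc n - n) + n" using e(4) by (cases N) auto
      finally have "e = (k ^ Suc n * f ^ (N * Suc n - n)) * f ^ n" by (simp only: power_add mult.assoc)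
      then show ?thesis by blast
    qed
    have "trivial_on scale e"
      unfolding trivial_on_def
    proof (intro conjI exI[of _ "scale e e0"] allI impI)
      show "e * e = e" by (rule e(1))
      show "scale e (scale e e0) = scale e e0" by (simp only: L.scale_scale e(1))
      show "\<exists>a. scale e l = scale a (scale e e0)" for l
      proof -
        obtain n a where a: "scale (f ^ n) l = scale a e0" using e0(1) by blast
        obtain w where w: "e = w * f ^ n" using e_pow by blast
        have "scale e l = scale (e * w) (scale (f ^ n) l)"
          unfolding L.scale_scale mult.assoc w[symmetric] e(1) ..
        also have "\<dots> = scale (w * a) (scale e e0)"
          unfolding a by (simp only: L.scale_scale mult_ac)
        finally show ?thesis by blast
      qed
      show "a * e = 0" if "scale a (scale e e0) = 0" for a
      proof -
        have "scale (a * e) e0 = 0" using that by (simp only: L.scale_scale)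
        then obtain n where n: "f ^ n * (a * e) = 0" using e0(2) by blast
        obtain w where w: "e = w * f ^ n" using e_pow by blast
        have "a * e = a * (e * e)" by (simp only: e(1))
        also have "\<dots> = a * ((w * f ^ n) * e)" using w by metis
        also have "\<dots> = w * (f ^ n * (a * e))" by (simp only: mult_ac)
        finally show ?thesis by (simp add: n)
      qed
    qed
    with e(3) show ?thesis by blast
  qed
  obtain e where e: "trivial_on scale e"
    and min: "\<And>e'. trivial_on scale e' \<Longrightarrow> A.dim (range ((*) (1 - e))) \<le> A.dim (range ((*) (1 - e')))"
    using ex_has_least_nat[of "trivial_on scale" 0 "\<lambda>e. A.dim (range ((*) (1 - e)))"] trivial_on_zero[OF L.module_axioms] by blast
  have ee: "e * e = e" using e by (simp add: trivial_on_def)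
  define d where "d = 1 - e"
  have dd: "d * d = d" and ed: "e * d = 0" by (simp_all add: d_def algebra_simps ee)
  \<comment> \<open>The module is also trivial on the part of D(f) outside D(e), given by
    \<open>e' * d\<close>. By minimality, adding this to \<open>e\<close> gains nothing, so
    \<open>d * e' = 0\<close>.\<close>
  have kill: "\<exists>N. d * f ^ N = 0" if f: "f \<in> C" for f
  proof -
    obtain e' N where e': "trivial_on scale e'" "e' * f ^ N = f ^ N" using local[OF f] by blast
    have ee': "e' * e' = e'" using e'(1) by (simp add: trivial_on_def)
    have "e * (e' * d) = 0" using ed by (metis mult.left_commute mult_zero_right)
    then have "trivial_on scale (e + e' * d)"
      using e trivial_on_mult[OF L.module_axioms e'(1) dd] trivial_on_add[OF L.module_axioms] by blast
    then have le: "A.dim (range ((*) d)) \<le> A.dim (range ((*) (1 - (e + e' * d))))"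
      using min unfolding d_def by blast
    have eq: "1 - (e + e' * d) = d * (1 - e')" by (simp add: d_def algebra_simps)
    have "range ((*) (d * (1 - e'))) \<subseteq> range ((*) d)" by (auto simp: image_iff mult.assoc)
    then have "range ((*) (d * (1 - e'))) = range ((*) d)"
      using le unfolding eq by (intro A.subspace_dim_equal subspace_multiples)
    moreover have "d \<in> range ((*) d)" using rangeI[of "(*) d" 1] by simp
    ultimately obtain b where b: "d = d * (1 - e') * b" by blast
    have "(1 - e') * e' = 0" by (simp add: algebra_simps ee')
    have "d * e' = d * (1 - e') * b * e'" by (simp only: b[symmetric])
    also have "\<dots> = d * b * ((1 - e') * e')" by (simp only: mult_ac)
    finally have "d * e' = 0" using \<open>(1 - e') * e' = 0\<close> by simp
    then have "d * f ^ N = 0" using e'(2) by (metis mult.assoc mult_zero_left)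
    then show ?thesis by blast
  qed
  \<comment> \<open>The elements with some power killed by \<open>d\<close> form an ideal by the
    binomial theorem; it contains \<open>C\<close> and hence 1.\<close>
  have "\<exists>N. d * a ^ N = 0" for a
  proof -
    have "a \<in> ideal.span C" by (simp add: C)
    then show ?thesis
    proof (induction rule: ideal.span_induct_alt)
      case base
      show ?case by (rule exI[of _ 1]) simp
    next
      case (step c f a)
      obtain n m where n: "d * f ^ n = 0" and m: "d * a ^ m = 0" using kill[OF step(1)] step(2) by blast
      have "d * (c * f + a) ^ (n + m)
          = (\<Sum>k\<le>n + m. of_nat ((n + m) choose k) * (d * ((c * f) ^ k * a ^ (n + m - k))))"
        by (simp add: binomial_ring sum_distrib_left mult_ac)
      also have "\<dots> = 0"
      proof (intro sum.neutral ballI)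
        fix k
        have "d * ((c * f) ^ k * a ^ (n + m - k)) = 0"
        proof (cases "n \<le> k")
          case True
          then have "f ^ k = f ^ n * f ^ (k - n)" by (simp add: power_add[symmetric])
          then have "d * ((c * f) ^ k * a ^ (n + m - k)) = (d * f ^ n) * (c ^ k * f ^ (k - n) * a ^ (n + m - k))"
            by (simp only: power_mult_distrib mult_ac)
          then show ?thesis by (simp add: n)
        next
          case False
          then have "n + m - k = m + (n - k)" by simp
          then have "a ^ (n + m - k) = a ^ m * a ^ (n - k)" by (simp only: power_add)
          then have "d * ((c * f) ^ k * a ^ (n + m - k)) = (d * a ^ m) * ((c * f) ^ k * a ^ (n - k))"
            by (simp only: mult_ac)
          then show ?thesis by (simp add: m)
        qed
        then show "of_nat ((n + m) choose k) * (d * ((c * f) ^ k * a ^ (n + m - k))) = 0" by simp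
      qed
      finally show ?case by blast
    qed
  qed
  from this[of 1] have "d = 0" by simp
  then have "e = 1" by (simp add: d_def)
  then show thesis using e that unfolding trivial_on_def by auto
qed

end

section \<open>Self-association in terms of a trivialization\<close>

context finite_projective_scheme begin

sublocale finite_algebra \<iota>
  by unfold_locales (fact \<iota>_one \<iota>_add \<iota>_mult finite_dim)+

sublocale L: module scale
  using line_bundle by (simp add: line_bundle_def)

sublocale Lk: vector_space "\<lambda>c. scale (\<iota> c)"
  by unfold_locales (simp_all add: L.scale_right_distrib L.scale_left_distrib \<iota>_add \<iota>_mult \<iota>_one)

definition gen :: 'l
  where "gen = (SOME g. (\<forall>l. \<exists>a. l = scale a g) \<and> (\<forall>a. scale a g = 0 \<longrightarrow> a = 0))"

lemma gen: "(\<forall>l. \<exists>a. l = scale a gen) \<and> (\<forall>a. scale a gen = 0 \<longrightarrow> a = 0)"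
  unfolding gen_def
proof (rule someI_ex)
  show "\<exists>g. (\<forall>l. \<exists>a. l = scale a g) \<and> (\<forall>a. scale a g = 0 \<longrightarrow> a = 0)"
    using line_bundle_trivial[OF line_bundle] by metis
qed

text \<open>The inverse of the isomorphism a \<mapsto> a gen from the algebra to the line
  bundle.\<close>

definition coord :: "'l \<Rightarrow> 'a"
  where "coord l = (SOME a. l = scale a gen)"

lemma scale_coord: "scale (coord l) gen = l"
proof -
  have "\<exists>a. l = scale a gen" using gen by blast
  from someI_ex[OF this] show ?thesis unfolding coord_def by simp
qed

lemma coord_eqI:
  assumes "scale a gen = l" shows "coord l = a"
proof -
  have "scale (coord l - a) gen = 0" by (simp add: L.scale_left_diff_distrib scale_coord assms)
  then show ?thesis using gen by auto
qed

lemma coord_gen [simp]: "coord (scale a gen) = a"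
  by (rule coord_eqI) simp

lemma coord_add: "coord (l + m) = coord l + coord m"
  by (rule coord_eqI) (simp add: L.scale_left_distrib scale_coord)

lemma coord_scale: "coord (scale a l) = a * coord l"
proof (rule coord_eqI)
  show "scale (a * coord l) gen = scale a l" unfolding L.scale_scale[symmetric] scale_coord ..
qed

lemma coord_0 [simp]: "coord 0 = 0"
  by (rule coord_eqI) simp

lemma coord_eq_iff: "coord l = coord m \<longleftrightarrow> l = m"
  by (metis scale_coord)

lemma module_hom_coord: "module_hom scale (*) coord"
  by unfold_locales (simp_all add: coord_add coord_scale)

text \<open>Every \<xi> is \<open>coord\<close> times the constant \<open>\<xi> gen\<close>, whose
  power comes out of a form. Hence testing with all \<xi> amounts to testing with
  \<open>coord\<close>.\<close>

lemma poly_value_hom: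
  assumes "module_hom scale (*) \<xi>" "form d F"
  shows "poly_value \<iota> F (\<xi> \<circ> s) = \<xi> gen ^ d * poly_value \<iota> F (coord \<circ> s)"
proof -
  interpret \<xi>: module_hom scale "(*)" \<xi> by fact
  have \<xi>: "\<xi> l = \<xi> gen * coord l" for l
    using \<xi>.scale[of "coord l" gen] by (simp add: scale_coord mult.commute)
  have eq: "\<xi> \<circ> s = (\<lambda>i. \<xi> gen * (coord \<circ> s) i)"
    unfolding comp_apply by (rule ext) (simp only: comp_apply \<xi>[symmetric])
  show ?thesis unfolding eq by (rule poly_value_scale[OF assms(2)])
qed

lemma vanishing_iff:
  assumes "form d F"
  shows "(\<forall>\<xi>. module_hom scale (*) \<xi> \<longrightarrow> poly_value \<iota> F (\<xi> \<circ> s) = 0) \<longleftrightarrow> poly_value \<iota> F (coord \<circ> s) = 0"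
  using poly_value_hom[OF _ assms] module_hom_coord by (metis mult_zero_right)

end

section \<open>Plane schemes in coordinates\<close>

locale plane_scheme = finite_projective_scheme \<iota> scale s
  for \<iota> :: "'k::field \<Rightarrow> 'a::comm_ring_1" and scale :: "'a \<Rightarrow> 'l::ab_group_add \<Rightarrow> 'l" and s :: "3 \<Rightarrow> 'l" +
  assumes nondegenerate
begin

sublocale plane_algebra \<iota> "coord \<circ> s"
proof unfold_locales
  have "\<exists>u v w. coord l = u * coord (s 0) + v * coord (s 1) + w * coord (s 2)" for l
  proof -
    have "l \<in> L.span (range s)" using generated by simp
    then show ?thesis
    proof (induction rule: L.span_induct_alt)
      case base
      show ?case by (intro exI[of _ 0]) simp
    next
      case (step c m l)
      then obtain u v w i where u: "coord l = u * coord (s 0) + v * coord (s 1) + w * coord (s 2)" and i: "m = s i"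
        by blast
      consider "i = 0" | "i = 1" | "i = 2" using exhaust_3[of i] by auto
      then show ?case
      proof cases
        case 1
        then have "coord (scale c m + l) = (c + u) * coord (s 0) + v * coord (s 1) + w * coord (s 2)"
          by (simp add: coord_add coord_scale u i distrib_right add_ac)
        then show ?thesis by blast
      next
        case 2
        then have "coord (scale c m + l) = u * coord (s 0) + (c + v) * coord (s 1) + w * coord (s 2)"
          by (simp add: coord_add coord_scale u i distrib_right add_ac)
        then show ?thesis by blast
      next
        case 3
        then have "coord (scale c m + l) = u * coord (s 0) + v * coord (s 1) + (c + w) * coord (s 2)"
          by (simp add: coord_add coord_scale u i distrib_right add_ac)
        then show ?thesis by blast
      qed
    qed
  qed
  from this[of "scale 1 gen"]
  show "\<exists>u v w. u * (coord \<circ> s) 0 + v * (coord \<circ> s) 1 + w * (coord \<circ> s) 2 = 1"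
    unfolding coord_gen by (metis comp_apply)
  show "\<exists>d F. form (Suc d) F \<and> poly_value \<iota> F (coord \<circ> s) = (coord \<circ> s) i ^ d * l" for i l
    using closed_immersion[of i "scale l gen"] module_hom_coord by (metis coord_gen comp_apply)
  show "r = 0 \<and> u = 0 \<and> t = 0"
    if "\<iota> r * (coord \<circ> s) 0 + \<iota> u * (coord \<circ> s) 1 + \<iota> t * (coord \<circ> s) 2 = 0" for r u t
  proof -
    define c where "c i = (if i = 0 then r else if i = 1 then u else t)" for i :: 3
    \<comment> \<open>In the type \<open>3\<close> the numeral 3 equals 0, which matches the last
      term of the sum over \<open>UNIV\<close> with the coordinate of index 0.\<close>
    have ne: "(1::3) \<noteq> 0" "(2::3) \<noteq> 0" "(2::3) \<noteq> 1" "(3::3) = 0" by simp_all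
    have "coord (\<Sum>i\<in>UNIV. scale (\<iota> (c i)) (s i)) = coord 0"
      using that by (simp add: sum_3 c_def ne coord_add coord_scale add_ac)
    then have "\<forall>i. c i = 0"
      using plane_scheme_axioms unfolding coord_eq_iff plane_scheme_def plane_scheme_axioms_def nondegenerate_def by blast
    then show ?thesis using ne unfolding c_def by metis
  qed
qed

lemma homogeneous_ideal_eq: "homogeneous_ideal = ideal.span vanishing_forms"
  unfolding homogeneous_ideal_def vanishing_forms_def using vanishing_iff by (metis (no_types, lifting))

lemma complete_intersection_iff:
  "complete_intersection [q, c] \<longleftrightarrow> ideal.span vanishing_forms = ideal.span {q, c}"
  by (simp add: complete_intersection_def homogeneous_ideal_eq)

lemma V_iff: "l \<in> V \<longleftrightarrow> coord l \<in> W 1"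
proof
  assume "l \<in> V"
  then have "l \<in> Lk.span (range s)" by (simp add: V_def)
  then show "coord l \<in> W 1"
  proof (induction rule: Lk.span_induct_alt)
    case base
    show ?case unfolding coord_0 by (rule W_zero)
  next
    case (step c m l)
    then obtain i where "m = s i" by blast
    then have "coord m \<in> W 1" using crd_in_W1[of i] by (metis comp_apply)
    then show ?case unfolding coord_add coord_scale using step(2) by (intro W_add W_scale)
  qed
next
  assume "coord l \<in> W 1"
  then obtain r u t where "coord l = \<iota> r * (coord \<circ> s) 0 + \<iota> u * (coord \<circ> s) 1 + \<iota> t * (coord \<circ> s) 2"
    by (rule W1_E)
  then have "coord l = coord (scale (\<iota> r) (s 0) + scale (\<iota> u) (s 1) + scale (\<iota> t) (s 2))"
    by (simp add: coord_add coord_scale)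
  then have "l = scale (\<iota> r) (s 0) + scale (\<iota> u) (s 1) + scale (\<iota> t) (s 2)"
    by (simp only: coord_eq_iff)
  moreover have "scale (\<iota> r) (s 0) + scale (\<iota> u) (s 1) + scale (\<iota> t) (s 2) \<in> V"
    unfolding V_def by (intro Lk.span_add Lk.span_scale Lk.span_base rangeI)
  ultimately show "l \<in> V" by (simp only:)
qed

lemma perp_iff:
  assumes "Vector_Spaces.linear sc (*) \<phi>"
  shows "h \<in> perp \<phi> \<longleftrightarrow> (\<forall>w\<in>W 1. \<phi> (h * w) = 0)"
proof
  interpret \<phi>: Vector_Spaces.linear sc "(*)" \<phi> by fact
  assume h: "h \<in> perp \<phi>"
  show "\<forall>w\<in>W 1. \<phi> (h * w) = 0"
  proof
    fix w assume "w \<in> W 1"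
    then obtain r u t where "w = \<iota> r * (coord \<circ> s) 0 + \<iota> u * (coord \<circ> s) 1 + \<iota> t * (coord \<circ> s) 2"
      by (rule W1_E)
    then have "h * w = \<iota> r * (h * (coord \<circ> s) 0) + \<iota> u * (h * (coord \<circ> s) 1) + \<iota> t * (h * (coord \<circ> s) 2)"
      by (simp only: distrib_left mult.left_commute)
    then show "\<phi> (h * w) = 0" using h unfolding perp_def by (simp only: mem_Collect_eq \<phi>.add \<phi>.scale) simp
  qed
next
  assume "\<forall>w\<in>W 1. \<phi> (h * w) = 0"
  then show "h \<in> perp \<phi>" unfolding perp_def using crd_in_W1 by blast
qed

text \<open>With \<open>\<phi> = \<Phi> gen gen\<close>, linearity over the algebra makes
  \<open>\<Phi>\<close> the pairing (l, m, b) \<mapsto> \<phi> (coord l * coord m * b). Surjectivity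
  of \<open>\<Phi>\<close> gives representability, and self-orthogonality holds because
  \<open>V\<close> is carried onto \<open>V_perp\<close>.\<close>

lemma self_associated_imp_dual_generator:
  assumes self_associated
  obtains \<phi> where "Vector_Spaces.linear sc (*) \<phi>"
    "\<And>\<psi>. Vector_Spaces.linear sc (*) \<psi> \<Longrightarrow> \<exists>h. \<psi> = (\<lambda>u. \<phi> (h * u))" "perp \<phi> = W 1"
proof -
  obtain \<Phi> where bij: "bij_betw \<Phi> UNIV K_minus_one"
    and sc: "\<And>a l. \<Phi> (scale a l) = (\<lambda>x. K_scale a (\<Phi> l x))" and V: "\<Phi> ` V = V_perp"
    using assms unfolding self_associated_def by blast
  have mem: "\<Phi> l \<in> K_minus_one" for l using bij by (auto simp: bij_betw_def)
  define \<phi> where "\<phi> = \<Phi> gen gen"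
  have lin: "Vector_Spaces.linear sc (*) \<phi>"
    using mem[of gen] unfolding \<phi>_def K_minus_one_def K_def by blast
  have \<Phi>: "\<Phi> (scale h gen) m = (\<lambda>u. \<phi> (h * coord m * u))" for h m
  proof -
    have "\<Phi> gen (scale (coord m) gen) = K_scale (coord m) \<phi>"
      using mem[of gen] unfolding \<phi>_def K_minus_one_def by blast
    then have "\<Phi> gen m = K_scale (coord m) \<phi>" by (simp only: scale_coord)
    then show ?thesis unfolding sc by (simp add: K_scale_def mult_ac)
  qed
  show thesis
  proof
    show "Vector_Spaces.linear sc (*) \<phi>" by (rule lin)
    show "\<exists>h. \<psi> = (\<lambda>u. \<phi> (h * u))" if \<psi>: "Vector_Spaces.linear sc (*) \<psi>" for \<psi>
    proof -
      interpret \<psi>: Vector_Spaces.linear sc "(*)" \<psi> by fact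
      have "Vector_Spaces.linear sc (*) (\<lambda>b. \<psi> (a * b))" for a
        by unfold_locales (simp_all only: distrib_left \<psi>.add mult.left_commute[of a] \<psi>.scale)
      \<comment> \<open>The functional \<psi> extends to the element of \<open>K_minus_one\<close>
        with value \<psi> at \<open>gen\<close>; its preimage under \<open>\<Phi>\<close> has
        coordinate h.\<close>
      then have "(\<lambda>l b. \<psi> (coord l * b)) \<in> K_minus_one"
        unfolding K_minus_one_def K_def K_scale_def
        by (intro CollectI conjI allI)
          (blast, simp_all only: coord_add coord_scale distrib_right \<psi>.add, simp only: mult_ac)
      then have "(\<lambda>l. K_scale (coord l) \<psi>) \<in> K_minus_one" by (simp only: K_scale_def)
      then obtain l where l: "\<Phi> l = (\<lambda>l. K_scale (coord l) \<psi>)"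
        using bij unfolding bij_betw_def by (metis imageE)
      have "\<Phi> (scale (coord l) gen) gen = K_scale (coord gen) \<psi>" by (simp add: scale_coord l)
      moreover have "coord gen = 1" by (rule coord_eqI) simp
      ultimately have "\<psi> = (\<lambda>u. \<phi> (coord l * u))" by (simp add: \<Phi> K_scale_def)
      then show ?thesis by blast
    qed
    have "h \<in> perp \<phi> \<longleftrightarrow> h \<in> W 1" for h
    proof -
      have "h \<in> perp \<phi> \<longleftrightarrow> (\<forall>v\<in>V. \<phi> (h * coord v) = 0)"
        unfolding perp_iff[OF lin] by (metis V_iff coord_gen)
      also have "\<dots> \<longleftrightarrow> \<Phi> (scale h gen) \<in> V_perp"
        by (simp add: V_perp_def trace_def \<Phi> mem)
      also have "\<dots> \<longleftrightarrow> scale h gen \<in> V"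
        unfolding V[symmetric] using bij by (auto simp: bij_betw_def inj_image_mem_iff)
      also have "\<dots> \<longleftrightarrow> h \<in> W 1" by (simp add: V_iff)
      finally show ?thesis .
    qed
    then show "perp \<phi> = W 1" by blast
  qed
qed

text \<open>The pairing above, read backwards, defines \<open>\<Phi>\<close>. It is injective by
  nondegeneracy, and onto because an element of \<open>K_minus_one\<close> is determined by its
  value at \<open>gen\<close>, a functional that \<open>riesz_representation\<close> represents by
  some h.\<close>

lemma dual_generator_imp_self_associated:
  assumes lin: "Vector_Spaces.linear sc (*) \<phi>"
    and nondeg: "\<And>h. (\<And>u. \<phi> (h * u) = 0) \<Longrightarrow> h = 0"
    and perp: "perp \<phi> = W 1"
  shows self_associated
proof -
  interpret \<phi>: Vector_Spaces.linear sc "(*)" \<phi> by fact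
  have mult_lin: "Vector_Spaces.linear sc (*) (\<lambda>b. \<phi> (a * b))" for a
    by unfold_locales (simp_all only: distrib_left \<phi>.add mult.left_commute[of a] \<phi>.scale)
  have mult_lin': "Vector_Spaces.linear sc (*) (\<lambda>b. \<phi> (b * a))" for a
    using mult_lin[of a] by (simp add: mult.commute)
  define \<Phi> where "\<Phi> l = (\<lambda>m b. \<phi> (coord l * coord m * b))" for l m
  have mem: "\<Phi> l \<in> K_minus_one" for l
    unfolding K_minus_one_def K_def K_scale_def \<Phi>_def using mult_lin
    by (intro CollectI conjI allI)
      (blast, simp_all only: coord_add coord_scale distrib_left distrib_right \<phi>.add mult_ac)
  have gen1: "coord gen = 1" by (rule coord_eqI) simp
  have "inj \<Phi>"
  proof (rule injI)
    fix l m assume eq: "\<Phi> l = \<Phi> m"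
    have "\<phi> ((coord l - coord m) * u) = 0" for u
      using fun_cong[OF fun_cong[OF eq, of gen], of u] by (simp add: \<Phi>_def gen1 left_diff_distrib \<phi>.diff)
    then have "coord l - coord m = 0" by (rule nondeg)
    then show "l = m" by (simp add: coord_eq_iff)
  qed
  moreover have "range \<Phi> = K_minus_one"
  proof
    show "range \<Phi> \<subseteq> K_minus_one" using mem by blast
    show "K_minus_one \<subseteq> range \<Phi>"
    proof
      fix \<Psi> assume \<Psi>: "\<Psi> \<in> K_minus_one"
      then have "Vector_Spaces.linear sc (*) (\<Psi> gen)" by (auto simp: K_minus_one_def K_def)
      then obtain h where h: "\<Psi> gen = (\<lambda>u. \<phi> (h * u))"
        using A.riesz_representation[of "\<lambda>u v. \<phi> (u * v)" "\<Psi> gen"] mult_lin mult_lin' nondeg by metis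
      have "\<Psi> m = \<Phi> (scale h gen) m" for m
      proof -
        have "\<Psi> (scale (coord m) gen) = K_scale (coord m) (\<Psi> gen)" using \<Psi> unfolding K_minus_one_def by blast
        then show ?thesis by (simp add: scale_coord \<Phi>_def h K_scale_def mult_ac)
      qed
      then show "\<Psi> \<in> range \<Phi>" by blast
    qed
  qed
  ultimately have bij: "bij_betw \<Phi> UNIV K_minus_one" by (simp add: bij_betw_def)
  have mem_iff: "\<Phi> l \<in> V_perp \<longleftrightarrow> l \<in> V" for l
  proof -
    have "\<Phi> l \<in> V_perp \<longleftrightarrow> (\<forall>v\<in>V. \<phi> (coord l * coord v) = 0)"
      unfolding V_perp_def trace_def using mem by (simp add: \<Phi>_def)
    also have "\<dots> \<longleftrightarrow> coord l \<in> perp \<phi>"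
      unfolding perp_iff[OF lin] by (metis V_iff coord_gen)
    also have "\<dots> \<longleftrightarrow> l \<in> V" unfolding perp V_iff ..
    finally show ?thesis .
  qed
  have "\<Phi> ` V = V_perp"
  proof
    show "\<Phi> ` V \<subseteq> V_perp" using mem_iff by blast
    show "V_perp \<subseteq> \<Phi> ` V"
    proof
      fix \<Psi> assume "\<Psi> \<in> V_perp"
      moreover from this have "\<Psi> \<in> range \<Phi>" using \<open>range \<Phi> = K_minus_one\<close> by (simp add: V_perp_def)
      ultimately show "\<Psi> \<in> \<Phi> ` V" using mem_iff by blast
    qed
  qed
  moreover have "\<Phi> (l + m) = (\<lambda>x b. \<Phi> l x b + \<Phi> m x b)" for l m
    by (simp add: \<Phi>_def coord_add distrib_right \<phi>.add)
  moreover have "\<Phi> (scale a l) = (\<lambda>x. K_scale a (\<Phi> l x))" for a l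
    by (simp add: \<Phi>_def coord_scale K_scale_def mult_ac)
  ultimately show ?thesis using bij unfolding self_associated_def by blast
qed

end

theorem theorem9p5:
  fixes \<iota> :: "'k::field \<Rightarrow> 'a::comm_ring_1"
    and scale :: "'a \<Rightarrow> 'l::ab_group_add \<Rightarrow> 'l"
    and s :: "3 \<Rightarrow> 'l"
  assumes "finite_projective_scheme \<iota> scale s"
    and "finite_projective_scheme.gorenstein \<iota>"
    and "finite_projective_scheme.nondegenerate \<iota> scale s"
  shows "finite_projective_scheme.self_associated \<iota> scale s \<longleftrightarrow>
    (\<exists>q c. form 2 q \<and> q \<noteq> 0 \<and> form 3 c \<and> c \<noteq> 0 \<and>
      finite_projective_scheme.complete_intersection \<iota> scale s [q, c])"
proof -
  interpret plane_scheme \<iota> scale s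
    using assms(1,3) by (simp add: plane_scheme_def plane_scheme_axioms_def)
  show ?thesis
    unfolding complete_intersection_iff
  proof
    assume self_associated
    then obtain \<phi> where \<phi>: "Vector_Spaces.linear sc (*) \<phi>"
      "\<And>\<psi>. Vector_Spaces.linear sc (*) \<psi> \<Longrightarrow> \<exists>h. \<psi> = (\<lambda>u. \<phi> (h * u))" "perp \<phi> = W 1"
      using self_associated_imp_dual_generator by blast
    interpret self_dual_plane_algebra \<iota> "coord \<circ> s" \<phi>
      by (intro self_dual_plane_algebra.intro self_dual_plane_algebra_axioms.intro plane_algebra_axioms \<phi>)
    show "\<exists>q c. form 2 q \<and> q \<noteq> 0 \<and> form 3 c \<and> c \<noteq> 0 \<and> ideal.span vanishing_forms = ideal.span {q, c}"
      using conic_cubic_generators by metis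
  next
    assume "\<exists>q c. form 2 q \<and> q \<noteq> 0 \<and> form 3 c \<and> c \<noteq> 0 \<and> ideal.span vanishing_forms = ideal.span {q, c}"
    then obtain q c where qc: "form 2 q" "form 3 c" "ideal.span vanishing_forms = ideal.span {q, c}" by blast
    interpret conic_cubic_plane_algebra \<iota> "coord \<circ> s" q c
      by unfold_locales (fact qc)+
    show self_associated
      using dual_generator dual_generator_imp_self_associated by metis
  qed
qed

end
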